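(* Let $s,p\in\mathbb{R}$, $\alpha>1/2$ and $\alpha'\ge0$ satisfy $\min\{\alpha,\alpha'\}+s>0$ and $\min\{\alpha,\alpha'\}+(p-1/2)>0$. Suppose that $l^\dagger=\{l_j^\dagger\}\in\mathcal{H}^s$; that the prior variances satisfy $\sigma_j^2=\Theta(j^{-2p})$ as $j\to\infty$; that the training and test covariances satisfy $\vartheta_j^2=\langle\varphi_j,\Lambda\varphi_j\rangle=\Theta(j^{-2\alpha})$ and $\vartheta_j'^2=\langle\varphi_j,\Lambda'\varphi_j\rangle=\Theta(j^{-2\alpha'})$ as $j\to\infty$; and that the training distribution $\nu$ satisfies the moment assumption (M) in the context. Let $J_N=\lfloor N^{1/(2(\alpha+p))}\rfloor$ and $$\rho_N=\begin{cases}N^{-\left(1-\frac{\alpha+1/2-\alpha'}{\alpha+p}\right)},&\alpha'<\alpha+1/2,\\ N^{-1}\log N,&\alpha'=\alpha+1/2,\\ N^{-1},&\alpha'>\alpha+1/2.\end{cases}$$ Then for any positive sequence $\{\tau_n\}$ such that $\tau_n\to0$ and $n\tau_n\to\infty$ as $n\to\infty$, the posterior mean test error satisfies $$\mathbb{E}^{D_N}\bigl\|L^\dagger-\bar L^{(N)}\bigr\|^2_{L^2_{\nu'}(H;H)}=\Omega\Bigl(\tau_N\rho_N+\sum_{j>J_N}j^{-2\alpha'}|l_j^\dagger|^2\Bigr)\quad\text{as }N\to\infty.$$ The same assertion holds for the test error of the full posterior, but without $\{\tau_n\}$: $$\mathbb{E}^{D_N}\mathbb{E}^{L^{(N)}\sim\mu^{D_N}}\bigl\|L^\dagger-L^{(N)}\bigr\|^2_{L^2_{\nu'}(H;H)}=\Omega\Bigl(\rho_N+\sum_{j>J_N}j^{-2\alpha'}|l_j^\dagger|^2\Bigr)\quad\text{as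 }N\to\infty.$$
   Context: $H$ is a real, separable, infinite-dimensional Hilbert space with inner product $\langle\cdot,\cdot\rangle$ and norm $\|\cdot\|$; $\{\varphi_j\}_{j\in\mathbb{N}}$ is a fixed known orthonormal basis of $H$. For $s\in\mathbb{R}$, $\mathcal{H}^s=\{v:\mathbb{N}\to\mathbb{R}:\|v\|_{\mathcal{H}^s}^2=\sum_jj^{2s}|v_j|^2<\infty\}$. For nonnegative sequences, $a_n=O(b_n)$ means $\limsup a_n/b_n<\infty$, $a_n=\Omega(b_n)$ means $b_n=O(a_n)$, $a_n=\Theta(b_n)$ means both, $a_n=o(b_n)$ means $a_n/b_n\to0$. Truth: $L^\dagger=\sum_jl_j^\dagger\varphi_j\otimes\varphi_j$ is a fixed, possibly unbounded, self-adjoint operator on $H$ with real eigenvalues $l_j^\dagger$ and domain $\{h\in H:\sum_j|l_j^\dagger|^2\langle\varphi_j,h\rangle^2<\infty\}$. Data: $\gamma>0$ is fixed; $\nu$ is a centered Borel probability measure on $H$ with finite second moment and strictly positive-definite trace-class covariance operator $\Lambda$; $x_1,\dots,x_N$ are i.i.d. from $\nu$; $g_{jn}=\langle\varphi_j,x_n\rangle$; $y_{jn}=g_{jn}l_j^\dagger+\gamma\xi_{jn}$ for $j\in\mathbb{N}$, $1\le n\le N$, with $\xi_{jn}$ i.i.d. $\mathcal{N}(0,1)$ independent of $X=(x_1,\dots,x_N)$. $Y=\{y_{jn}\}$, $D_N=(X,Y)$, and $\mathbb{E}^{D_N}$ is expectation over the joint law of $D_N$. Prior and posterior: the prior on the eigenvalues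 is $\bigotimes_j\mathcal{N}(0,\sigma_j^2)$ with $\sigma_j^2>0$ for all $j$. The posterior on the eigenvalues is $\bigotimes_j\mathcal{N}(\bar l_j^{(N)},(\sigma_j^{(N)})^2)$ with $$\bar l_j^{(N)}=\frac{N\gamma^{-2}\sigma_j^2\,\frac1N\sum_{n}y_{jn}g_{jn}}{1+N\gamma^{-2}\sigma_j^2\,\frac1N\sum_ng_{jn}^2},\qquad(\sigma_j^{(N)})^2=\frac{\sigma_j^2}{1+N\gamma^{-2}\sigma_j^2\,\frac1N\sum_ng_{jn}^2}.$$ $\mu^{D_N}$ is the law of $L^{(N)}=\sum_jl_j^{(N)}\varphi_j\otimes\varphi_j$ with $\{l_j^{(N)}\}$ drawn from this posterior; $\bar L^{(N)}=\sum_j\bar l_j^{(N)}\varphi_j\otimes\varphi_j$ is the posterior mean. Test distribution: $\nu'$ is a centered Borel probability measure with bounded covariance operator $\Lambda'\in\mathcal{L}(H)$ (possibly not trace-class). For $T=\sum_jt_j\varphi_j\otimes\varphi_j$, $\|T\|^2_{L^2_{\nu'}(H;H)}=\mathbb{E}^{x\sim\nu'}\|Tx\|^2=\sum_j\vartheta_j'^2t_j^2$, where $\vartheta_j'^2=\langle\varphi_j,\Lambda'\varphi_j\rangle$. Assumption (M): $x\sim\nu$ has Karhunen–Loève expansion $x=\sum_k\lambda_k\zeta_k\phi_k$, where $\{\phi_k\}$ is an orthonormal eigenbasis of $\Lambda$ with nonincreasing eigenvalues $\lambda_k^2$, and the zero mean, unit variance random variables $\{\zeta_k\}$ are independent, have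 finite fourth moments, and satisfy $\mathbb{E}[\zeta_k^4]=O(1)$ as $k\to\infty$. Moreover, there is a constant $C$ such that $\limsup_{N\to\infty}\mathbb{E}\bigl[(\frac1N\sum_{n=1}^Ng_{jn}^2)^{-4}\bigr]\le C\langle\varphi_j,\Lambda\varphi_j\rangle^{-4}$ for all $j\in\mathbb{N}$. *)

theory Defs
  imports "HOL-Probability.Probability" "HOL-Library.Landau_Symbols"
begin

text \<open>Sequences indexed by the positive integers are functions on \<^typ>\<open>nat\<close> restricted to
  \<open>{1..}\<close>; their value at \<open>0\<close> is never used.\<close>

definition orthonormal_basis :: "(nat \<Rightarrow> 'h::real_inner) \<Rightarrow> bool" where
  "orthonormal_basis \<phi> \<longleftrightarrow>
     (\<forall>i\<ge>1. \<forall>j\<ge>1. \<phi> i \<bullet> \<phi> j = (if i = j then 1 else 0)) \<and>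
     closure (span (\<phi> ` {1..})) = UNIV"

definition Hs :: "real \<Rightarrow> (nat \<Rightarrow> real) set" where
  "Hs s = {v. (\<lambda>j. real j powr (2 * s) * \<bar>v j\<bar>\<^sup>2) summable_on {1..}}"



text \<open>A bounded covariance operator on \<open>H\<close> does not force a measure to live on \<open>H\<close> (white noise,
  for instance, does not). A measure \<open>M\<close> on a space \<open>E\<close> is therefore accessed through a map \<open>b\<close>, where
  \<open>b h\<close> is (a measurable version of) the functional \<open>x \<mapsto> \<langle>h, x\<rangle>\<close> on \<open>E\<close>. For a measure on \<open>H\<close>
  itself, \<open>b\<close> is the inner product. Only second moments of each \<open>\<langle>h, x\<rangle>\<close> are required.\<close>

definition centered_wrt :: "('h \<Rightarrow> 'e \<Rightarrow> real) \<Rightarrow> 'e measure \<Rightarrow> bool" where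
  "centered_wrt b M \<longleftrightarrow> (\<forall>u. integrable M (b u) \<and> (\<integral>x. b u x \<partial>M) = 0)"

definition covariance_wrt ::
    "('h::real_inner \<Rightarrow> 'e \<Rightarrow> real) \<Rightarrow> 'e measure \<Rightarrow> ('h \<Rightarrow> 'h) \<Rightarrow> bool" where
  "covariance_wrt b M \<Lambda> \<longleftrightarrow> bounded_linear \<Lambda> \<and>
     (\<forall>u v. integrable M (\<lambda>x. b u x * b v x) \<and> (\<integral>x. b u x * b v x \<partial>M) = u \<bullet> \<Lambda> v)"

text \<open>The trace condition is the trace-class property of a nonnegative operator.\<close>

definition training_distribution ::
    "(nat \<Rightarrow> 'h::{real_inner, banach, second_countable_topology}) \<Rightarrow> 'h measure \<Rightarrow> ('h \<Rightarrow> 'h) \<Rightarrow> bool"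
  where
  "training_distribution \<phi> \<nu> \<Lambda> \<longleftrightarrow>
     prob_space \<nu> \<and> sets \<nu> = sets borel \<and>
     integrable \<nu> (\<lambda>x. (norm x)\<^sup>2) \<and> (\<integral>x. x \<partial>\<nu>) = 0 \<and>
     covariance_wrt inner \<nu> \<Lambda> \<and> (\<forall>u. u \<noteq> 0 \<longrightarrow> 0 < u \<bullet> \<Lambda> u) \<and>
     (\<lambda>j. \<phi> j \<bullet> \<Lambda> (\<phi> j)) summable_on {1..}"

definition test_distribution ::
    "('h::real_inner \<Rightarrow> 'e::topological_space \<Rightarrow> real) \<Rightarrow> 'e measure \<Rightarrow> ('h \<Rightarrow> 'h) \<Rightarrow> bool" where
  "test_distribution b \<nu>' \<Lambda>' \<longleftrightarrow>
     prob_space \<nu>' \<and> sets \<nu>' = sets borel \<and> centered_wrt b \<nu>' \<and> covariance_wrt b \<nu>' \<Lambda>'"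

text \<open>The possibly unbounded self-adjoint operator \<open>\<Sum>j. t\<^sub>j \<phi>\<^sub>j \<otimes> \<phi>\<^sub>j\<close> is given by its eigenvalue sequence
  \<open>t\<close>. With \<open>b = inner\<close>, \<open>diag_dom\<close> is its domain in \<open>H\<close>.\<close>

definition diag_dom ::
    "('h \<Rightarrow> 'e \<Rightarrow> real) \<Rightarrow> (nat \<Rightarrow> 'h) \<Rightarrow> (nat \<Rightarrow> real) \<Rightarrow> 'e set" where
  "diag_dom b \<phi> t = {x. (\<lambda>j. \<bar>t j\<bar>\<^sup>2 * (b (\<phi> j) x)\<^sup>2) summable_on {1..}}"

definition diag_op ::
    "('h::real_inner \<Rightarrow> 'e \<Rightarrow> real) \<Rightarrow> (nat \<Rightarrow> 'h) \<Rightarrow> (nat \<Rightarrow> real) \<Rightarrow> 'e \<Rightarrow> 'h" where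
  "diag_op b \<phi> t x = (\<Sum>\<^sub>\<infinity>j\<in>{1..}. (t j * b (\<phi> j) x) *\<^sub>R \<phi> j)"

definition L2_norm_sq ::
    "('h::real_inner \<Rightarrow> 'e \<Rightarrow> real) \<Rightarrow> (nat \<Rightarrow> 'h) \<Rightarrow> 'e measure \<Rightarrow> (nat \<Rightarrow> real) \<Rightarrow> ennreal" where
  "L2_norm_sq b \<phi> \<nu>' t =
     (\<integral>\<^sup>+x. (if x \<in> diag_dom b \<phi> t then ennreal ((norm (diag_op b \<phi> t x))\<^sup>2) else \<top>) \<partial>\<nu>')"



definition gaussian :: "real \<Rightarrow> real \<Rightarrow> real measure" where
  "gaussian m v = density lborel (\<lambda>x. ennreal (normal_density m (sqrt v) x))"

definition design_law :: "'h measure \<Rightarrow> nat \<Rightarrow> (nat \<Rightarrow> 'h) measure" where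
  "design_law \<nu> N = (\<Pi>\<^sub>M n\<in>{1..N}. \<nu>)"

definition noise_law :: "nat \<Rightarrow> (nat \<times> nat \<Rightarrow> real) measure" where
  "noise_law N = (\<Pi>\<^sub>M jn\<in>{1..} \<times> {1..N}. gaussian 0 1)"

text \<open>A data point is a pair \<open>(X, Y)\<close> with \<open>X n = x\<^sub>n\<close> and \<open>Y (j, n) = y\<^sub>j\<^sub>n\<close>.\<close>

type_synonym 'h data = "(nat \<Rightarrow> 'h) \<times> (nat \<times> nat \<Rightarrow> real)"

definition observe ::
    "(nat \<Rightarrow> 'h::real_inner) \<Rightarrow> (nat \<Rightarrow> real) \<Rightarrow> real \<Rightarrow> nat \<Rightarrow>
     (nat \<Rightarrow> 'h) \<times> (nat \<times> nat \<Rightarrow> real) \<Rightarrow> 'h data" where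
  "observe \<phi> l \<gamma> N = (\<lambda>(X, \<xi>).
     (X, \<lambda>(j, n)\<in>{1..} \<times> {1..N}. (\<phi> j \<bullet> X n) * l j + \<gamma> * \<xi> (j, n)))"

definition data_law ::
    "(nat \<Rightarrow> 'h::real_inner) \<Rightarrow> 'h measure \<Rightarrow> (nat \<Rightarrow> real) \<Rightarrow> real \<Rightarrow> nat \<Rightarrow> 'h data measure" where
  "data_law \<phi> \<nu> l \<gamma> N =
     distr (design_law \<nu> N \<Otimes>\<^sub>M noise_law N)
           (design_law \<nu> N \<Otimes>\<^sub>M (\<Pi>\<^sub>M jn\<in>{1..} \<times> {1..N}. borel))
           (observe \<phi> l \<gamma> N)"

text \<open>\<open>\<sigma> j\<close> is the prior standard deviation of the \<open>j\<close>-th eigenvalue.\<close>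

definition post_mean ::
    "(nat \<Rightarrow> 'h::real_inner) \<Rightarrow> (nat \<Rightarrow> real) \<Rightarrow> real \<Rightarrow> nat \<Rightarrow> 'h data \<Rightarrow> nat \<Rightarrow> real" where
  "post_mean \<phi> \<sigma> \<gamma> N = (\<lambda>(X, Y) j.
     (real N * (1 / \<gamma>\<^sup>2) * (\<sigma> j)\<^sup>2 * (1 / real N * (\<Sum>n=1..N. Y (j, n) * (\<phi> j \<bullet> X n)))) /
     (1 + real N * (1 / \<gamma>\<^sup>2) * (\<sigma> j)\<^sup>2 * (1 / real N * (\<Sum>n=1..N. (\<phi> j \<bullet> X n)\<^sup>2))))"

definition post_var ::
    "(nat \<Rightarrow> 'h::real_inner) \<Rightarrow> (nat \<Rightarrow> real) \<Rightarrow> real \<Rightarrow> nat \<Rightarrow> 'h data \<Rightarrow> nat \<Rightarrow> real" where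
  "post_var \<phi> \<sigma> \<gamma> N = (\<lambda>(X, Y) j.
     (\<sigma> j)\<^sup>2 / (1 + real N * (1 / \<gamma>\<^sup>2) * (\<sigma> j)\<^sup>2 * (1 / real N * (\<Sum>n=1..N. (\<phi> j \<bullet> X n)\<^sup>2))))"

text \<open>The law of the eigenvalue sequence of \<open>L\<^sup>(\<^sup>N\<^sup>)\<close> given the data.\<close>

definition posterior ::
    "(nat \<Rightarrow> 'h::real_inner) \<Rightarrow> (nat \<Rightarrow> real) \<Rightarrow> real \<Rightarrow> nat \<Rightarrow> 'h data \<Rightarrow> (nat \<Rightarrow> real) measure" where
  "posterior \<phi> \<sigma> \<gamma> N D = (\<Pi>\<^sub>M j\<in>{1..}. gaussian (post_mean \<phi> \<sigma> \<gamma> N D j) (post_var \<phi> \<sigma> \<gamma> N D j))"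

definition mean_test_error where
  "mean_test_error \<phi> \<nu> l \<gamma> \<sigma> b \<nu>' N =
     (\<integral>\<^sup>+D. L2_norm_sq b \<phi> \<nu>' (\<lambda>j. l j - post_mean \<phi> \<sigma> \<gamma> N D j) \<partial>data_law \<phi> \<nu> l \<gamma> N)"

definition full_test_error where
  "full_test_error \<phi> \<nu> l \<gamma> \<sigma> b \<nu>' N =
     (\<integral>\<^sup>+D. (\<integral>\<^sup>+lN. L2_norm_sq b \<phi> \<nu>' (\<lambda>j. l j - lN j) \<partial>posterior \<phi> \<sigma> \<gamma> N D) \<partial>data_law \<phi> \<nu> l \<gamma> N)"



definition karhunen_loeve_condition ::
    "'h::{real_inner, banach, second_countable_topology} measure \<Rightarrow> ('h \<Rightarrow> 'h) \<Rightarrow> bool" where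
  "karhunen_loeve_condition \<nu> \<Lambda> \<longleftrightarrow>
     (\<exists>(\<psi> :: nat \<Rightarrow> 'h) (lam :: nat \<Rightarrow> real) (\<zeta> :: nat \<Rightarrow> 'h \<Rightarrow> real).
        orthonormal_basis \<psi> \<and>
        (\<forall>k\<ge>1. \<Lambda> (\<psi> k) = (lam k)\<^sup>2 *\<^sub>R \<psi> k) \<and>
        (\<forall>k\<ge>1. (lam (Suc k))\<^sup>2 \<le> (lam k)\<^sup>2) \<and>
        (AE x in \<nu>. ((\<lambda>k. (lam k * \<zeta> k x) *\<^sub>R \<psi> k) has_sum x) {1..}) \<and>
        prob_space.indep_vars \<nu> (\<lambda>_. borel) \<zeta> {1..} \<and>
        (\<forall>k\<ge>1. integrable \<nu> (\<lambda>x. \<zeta> k x ^ 4) \<and>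
                (\<integral>x. \<zeta> k x \<partial>\<nu>) = 0 \<and> (\<integral>x. (\<zeta> k x)\<^sup>2 \<partial>\<nu>) = 1) \<and>
        (\<lambda>k. \<integral>x. \<zeta> k x ^ 4 \<partial>\<nu>) \<in> O(\<lambda>_. 1))"

text \<open>The inverse is taken in \<^typ>\<open>ennreal\<close>, where the inverse of \<open>0\<close> is \<open>\<infinity>\<close>.\<close>

definition inverse_moment_condition ::
    "(nat \<Rightarrow> 'h::real_inner) \<Rightarrow> 'h measure \<Rightarrow> ('h \<Rightarrow> 'h) \<Rightarrow> bool" where
  "inverse_moment_condition \<phi> \<nu> \<Lambda> \<longleftrightarrow>
     (\<exists>C::real. \<forall>j\<ge>1.
        limsup (\<lambda>N. \<integral>\<^sup>+X. inverse (ennreal ((1 / real N * (\<Sum>n=1..N. (\<phi> j \<bullet> X n)\<^sup>2)) ^ 4)) \<partial>design_law \<nu> N)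
          \<le> ennreal (C / (\<phi> j \<bullet> \<Lambda> (\<phi> j)) ^ 4))"

definition moment_assumption ::
    "(nat \<Rightarrow> 'h::{real_inner, banach, second_countable_topology}) \<Rightarrow> 'h measure \<Rightarrow> ('h \<Rightarrow> 'h) \<Rightarrow> bool"
  where
  "moment_assumption \<phi> \<nu> \<Lambda> \<longleftrightarrow>
     karhunen_loeve_condition \<nu> \<Lambda> \<and> inverse_moment_condition \<phi> \<nu> \<Lambda>"



definition J_cut :: "real \<Rightarrow> real \<Rightarrow> nat \<Rightarrow> nat" where
  "J_cut \<alpha> p N = nat \<lfloor>real N powr (1 / (2 * (\<alpha> + p)))\<rfloor>"

definition rate :: "real \<Rightarrow> real \<Rightarrow> real \<Rightarrow> nat \<Rightarrow> real" where
  "rate \<alpha> \<alpha>' p N =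
     (if \<alpha>' < \<alpha> + 1/2 then real N powr (- (1 - (\<alpha> + 1/2 - \<alpha>') / (\<alpha> + p)))
      else if \<alpha>' = \<alpha> + 1/2 then real N powr (-1) * ln (real N)
      else real N powr (-1))"

definition tail_sum :: "real \<Rightarrow> (nat \<Rightarrow> real) \<Rightarrow> nat \<Rightarrow> ennreal" where
  "tail_sum \<alpha>' l J = (\<Sum>\<^sub>\<infinity>j\<in>{J<..}. ennreal (real j powr (-2 * \<alpha>') * \<bar>l j\<bar>\<^sup>2))"

text \<open>Test errors may be infinite for small \<open>N\<close>, so the order relations between them are those of
  \<^typ>\<open>ennreal\<close>-valued sequences. There \<open>a / 0 = \<infinity>\<close> for \<open>a > 0\<close>, \<open>0 / 0 = 0\<close> and \<open>a / \<infinity> = 0\<close>.\<close>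

definition ennreal_bigo :: "(nat \<Rightarrow> ennreal) \<Rightarrow> (nat \<Rightarrow> ennreal) \<Rightarrow> bool" where
  "ennreal_bigo a b \<longleftrightarrow> limsup (\<lambda>n. a n / b n) < \<top>"

definition ennreal_bigomega :: "(nat \<Rightarrow> ennreal) \<Rightarrow> (nat \<Rightarrow> ennreal) \<Rightarrow> bool" where
  "ennreal_bigomega a b \<longleftrightarrow> ennreal_bigo b a"

end

theory Submission
  imports Defs
begin

text \<open>Both test errors split over the basis \<open>\<phi>\<close>. An operator with eigenvalues \<open>t\<^sub>j\<close> has squared norm at least
\<open>\<Sum>j\<in>F. \<langle>\<phi>\<^sub>j, \<Lambda>' \<phi>\<^sub>j\<rangle> t\<^sub>j\<^sup>2\<close> for every finite \<open>F\<close> (\<open>L2_norm_sq_ge_sum\<close>), and averaging over the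
posterior only adds the posterior variance to the squared error of its mean. So both errors are bounded below by
the same weighted sums of the mean squared errors of the posterior means of single eigenvalues.

For one coordinate, put \<open>g\<^sub>n = \<langle>\<phi>\<^sub>j, x\<^sub>n\<rangle>\<close>, \<open>G = (1/N) \<Sum> g\<^sub>n\<^sup>2\<close>, \<open>\<theta> = \<langle>\<phi>\<^sub>j, \<Lambda> \<phi>\<^sub>j\<rangle> = E G\<close> and
\<open>a = N \<sigma>\<^sub>j\<^sup>2 / \<gamma>\<^sup>2\<close>. Given the design, the noise average is explicit:
bias \<open>l\<^sub>j\<^sup>2 / (1 + a G)\<^sup>2\<close> plus variance \<open>(a \<gamma>)\<^sup>2 / N * G / (1 + a G)\<^sup>2\<close>.
Replacing \<open>G\<close> by its mean \<open>\<theta>\<close> costs only constants. For the bias this is convexity of \<open>z \<mapsto> 1/z\<^sup>2\<close>.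
For the variance one needs that \<open>G\<close> is of the order of \<open>\<theta>\<close> with positive probability, and this follows from
\<open>E g\<^sub>n\<^sup>4 \<le> K \<theta>\<^sup>2\<close> with \<open>K\<close> independent of \<open>j\<close>, as in the Paley-Zygmund inequality. The Karhunen-Loeve
expansion supplies such a \<open>K\<close>: a sum of independent centred variables has fourth moment at most a constant times its
squared variance, and Fatou's lemma passes to the infinite expansion. The result is \<open>coordinate_error_ge\<close>.

By the decay assumptions \<open>a \<theta>\<close> is of order \<open>N * j powr (-2 * (\<alpha> + p))\<close>, and \<open>J_cut\<close> is the index
where this quantity crosses \<open>1\<close>. Beyond the cut the bias stays of order \<open>l\<^sub>j\<^sup>2\<close>, and this gives the tail sum. Up to the
cut the variance is of order \<open>1 / (N \<theta>)\<close>, so its weighted sum is of order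
\<open>(1/N) \<Sum>j\<le>J. j powr (2 * (\<alpha> - \<alpha>'))\<close>. Depending on whether the exponent is above, equal to or below
\<open>-1\<close>, this partial sum is a power of \<open>J\<close>, a logarithm or a constant, and these are the three cases of \<open>rate\<close>.\<close>

section \<open>Orthonormal series and the test norm\<close>

lemma norm_sum_orthonormal:
  fixes \<phi> :: "'i \<Rightarrow> 'h::real_inner" and c :: "'i \<Rightarrow> real"
  assumes on: "\<And>i j. i \<in> I \<Longrightarrow> j \<in> I \<Longrightarrow> \<phi> i \<bullet> \<phi> j = (if i = j then 1 else 0)"
    and F: "finite F" "F \<subseteq> I"
  shows "(norm (\<Sum>i\<in>F. c i *\<^sub>R \<phi> i))\<^sup>2 = (\<Sum>i\<in>F. (c i)\<^sup>2)"
proof -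
  have "(norm (\<Sum>i\<in>F. c i *\<^sub>R \<phi> i))\<^sup>2 = (\<Sum>i\<in>F. \<Sum>j\<in>F. c i * (c j * (\<phi> i \<bullet> \<phi> j)))"
    by (simp add: power2_norm_eq_inner inner_sum_left inner_sum_right sum_distrib_left inner_commute mult_ac)
  also have "\<dots> = (\<Sum>i\<in>F. \<Sum>j\<in>F. if i = j then c i * c j else 0)"
    using F by (intro sum.cong refl) (auto simp: on subset_iff)
  also have "\<dots> = (\<Sum>i\<in>F. (c i)\<^sup>2)"
    using F by (simp add: power2_eq_square)
  finally show ?thesis .
qed

text \<open>The series need not converge absolutely, so completeness is used through the Cauchy criterion for the net of finite
partial sums: by Pythagoras, enlarging a finite index set moves the partial sum by the square root of the added
squared coefficients.\<close>

lemma summable_on_orthonormal: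
  fixes \<phi> :: "'i \<Rightarrow> 'h::{real_inner, banach}" and c :: "'i \<Rightarrow> real"
  assumes on: "\<And>i j. i \<in> I \<Longrightarrow> j \<in> I \<Longrightarrow> \<phi> i \<bullet> \<phi> j = (if i = j then 1 else 0)"
    and sq: "(\<lambda>i. (c i)\<^sup>2) summable_on I"
  shows "(\<lambda>i. c i *\<^sub>R \<phi> i) summable_on I"
proof -
  define f where "f = (\<lambda>i. c i *\<^sub>R \<phi> i)"
  define L where "L = infsum (\<lambda>i. (c i)\<^sup>2) I"
  have lim: "((\<lambda>F. \<Sum>i\<in>F. (c i)\<^sup>2) \<longlongrightarrow> L) (finite_subsets_at_top I)"
    using has_sum_infsum[OF sq] by (simp add: L_def has_sum_def)
  have le_L: "(\<Sum>i\<in>F. (c i)\<^sup>2) \<le> L" if "finite F" "F \<subseteq> I" for F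
    unfolding L_def by (rule finite_sum_le_infsum[OF sq that]) auto
  have "\<exists>P. eventually P (finite_subsets_at_top I) \<and>
            (\<forall>F F'. P F \<and> P F' \<longrightarrow> dist (sum f F) (sum f F') < e)" if e: "e > 0" for e
  proof -
    define P where "P F \<longleftrightarrow> (finite F \<and> F \<subseteq> I) \<and> dist (\<Sum>i\<in>F. (c i)\<^sup>2) L < (e/2)\<^sup>2" for F
    have ev: "eventually P (finite_subsets_at_top I)"
      unfolding P_def using lim e
      by (intro eventually_conj eventually_finite_subsets_at_top_weakI tendstoD) auto
    have close: "dist (sum f F) (sum f U) < e/2"
      if P: "P F" and U: "finite U" "F \<subseteq> U" "U \<subseteq> I" for F U
    proof -
      have "dist (sum f F) (sum f U) = norm (sum f (U - F))"
        using U by (simp add: dist_norm sum_diff norm_minus_commute[of "sum f F"])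
      then have "(dist (sum f F) (sum f U))\<^sup>2 = (norm (\<Sum>i\<in>U - F. c i *\<^sub>R \<phi> i))\<^sup>2"
        by (simp add: f_def)
      also have "\<dots> = (\<Sum>i\<in>U - F. (c i)\<^sup>2)"
        using U by (intro norm_sum_orthonormal[OF on]) auto
      also have "\<dots> = (\<Sum>i\<in>U. (c i)\<^sup>2) - (\<Sum>i\<in>F. (c i)\<^sup>2)"
        using U by (subst sum_diff) auto
      also have "\<dots> < (e/2)\<^sup>2"
        using P le_L[of U] U unfolding P_def dist_real_def by linarith
      finally show ?thesis
        by (rule power2_less_imp_less) (use e in simp)
    qed
    \<comment> \<open>Neither index set contains the other; both are compared with the union.\<close>
    have "dist (sum f F) (sum f F') < e" if "P F" "P F'" for F F'
    proof -
      have "dist (sum f F) (sum f F') \<le>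
          dist (sum f F) (sum f (F \<union> F')) + dist (sum f F') (sum f (F \<union> F'))"
        by (rule dist_triangle2)
      also have "\<dots> < e/2 + e/2"
        using that by (intro add_strict_mono close) (auto simp: P_def)
      finally show ?thesis by simp
    qed
    with ev show ?thesis by blast
  qed
  then have "cauchy_filter (filtermap (sum f) (finite_subsets_at_top I))"
    by (simp add: cauchy_filter_metric_filtermap)
  moreover have "uniform_space_class.complete (UNIV :: 'h set)"
    by (rule complete_UNIV)
  ultimately obtain L' where "(sum f \<longlongrightarrow> L') (finite_subsets_at_top I)"
    using complete_uniform[where S=UNIV] by (force simp add: filterlim_def)
  then show ?thesis
    unfolding summable_on_def has_sum_def f_def by blast
qed

lemma sum_le_norm_infsum_orthonormal:
  fixes \<phi> :: "'i \<Rightarrow> 'h::{real_inner, banach}" and c :: "'i \<Rightarrow> real"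
  assumes on: "\<And>i j. i \<in> I \<Longrightarrow> j \<in> I \<Longrightarrow> \<phi> i \<bullet> \<phi> j = (if i = j then 1 else 0)"
    and sq: "(\<lambda>i. (c i)\<^sup>2) summable_on I"
    and F: "finite F" "F \<subseteq> I"
  shows "(\<Sum>i\<in>F. (c i)\<^sup>2) \<le> (norm (\<Sum>\<^sub>\<infinity>i\<in>I. c i *\<^sub>R \<phi> i))\<^sup>2"
proof (rule tendsto_lowerbound)
  show "((\<lambda>U. (norm (\<Sum>i\<in>U. c i *\<^sub>R \<phi> i))\<^sup>2) \<longlongrightarrow> (norm (\<Sum>\<^sub>\<infinity>i\<in>I. c i *\<^sub>R \<phi> i))\<^sup>2)
          (finite_subsets_at_top I)"
    using has_sum_infsum[OF summable_on_orthonormal[OF on sq]]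
    by (auto simp: has_sum_def intro!: tendsto_intros)
  show "\<forall>\<^sub>F U in finite_subsets_at_top I. (\<Sum>i\<in>F. (c i)\<^sup>2) \<le> (norm (\<Sum>i\<in>U. c i *\<^sub>R \<phi> i))\<^sup>2"
    unfolding eventually_finite_subsets_at_top
    using F by (intro exI[of _ F]) (auto simp: norm_sum_orthonormal[OF on] intro!: sum_mono2)
qed simp

text \<open>Off the domain the integrand is infinite. On the domain the series defining the operator converges, and Bessel's
inequality bounds its norm below by finitely many coordinates. The finite sum is measurable, so it integrates term
by term; the integrand on the right is only compared pointwise.\<close>

lemma L2_norm_sq_ge_sum:
  fixes \<phi> :: "nat \<Rightarrow> 'h::{real_inner, banach}" and b :: "'h \<Rightarrow> 'e::topological_space \<Rightarrow> real"
  assumes basis: "orthonormal_basis \<phi>" and cov: "covariance_wrt b \<nu>' \<Lambda>'"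
    and F: "finite F" "F \<subseteq> {1..}"
  shows "(\<Sum>j\<in>F. ennreal (\<phi> j \<bullet> \<Lambda>' (\<phi> j)) * ennreal ((t j)\<^sup>2)) \<le> L2_norm_sq b \<phi> \<nu>' t"
proof -
  have on: "\<phi> i \<bullet> \<phi> j = (if i = j then 1 else 0)" if "i \<in> {1..}" "j \<in> {1..}" for i j
    using basis that by (auto simp: orthonormal_basis_def)
  have sq: "integrable \<nu>' (\<lambda>x. (b (\<phi> j) x)\<^sup>2)" "(\<integral>x. (b (\<phi> j) x)\<^sup>2 \<partial>\<nu>') = \<phi> j \<bullet> \<Lambda>' (\<phi> j)" for j
    using cov by (auto simp: covariance_wrt_def power2_eq_square)
  have "(\<Sum>j\<in>F. ennreal (\<phi> j \<bullet> \<Lambda>' (\<phi> j)) * ennreal ((t j)\<^sup>2)) =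
      (\<Sum>j\<in>F. ennreal (\<integral>x. (t j * b (\<phi> j) x)\<^sup>2 \<partial>\<nu>'))"
    by (intro sum.cong refl) (simp add: power_mult_distrib sq mult.commute flip: ennreal_mult'')
  also have "\<dots> = (\<Sum>j\<in>F. \<integral>\<^sup>+x. ennreal ((t j * b (\<phi> j) x)\<^sup>2) \<partial>\<nu>')"
    using sq(1) by (intro sum.cong refl nn_integral_eq_integral[symmetric]) (auto simp: power_mult_distrib)
  also have "\<dots> = (\<integral>\<^sup>+x. (\<Sum>j\<in>F. ennreal ((t j * b (\<phi> j) x)\<^sup>2)) \<partial>\<nu>')"
    using borel_measurable_integrable[OF sq(1)]
    by (intro nn_integral_sum[symmetric]) (auto simp: power_mult_distrib)
  also have "\<dots> \<le> L2_norm_sq b \<phi> \<nu>' t"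
    unfolding L2_norm_sq_def
  proof (intro nn_integral_mono)
    fix x
    show "(\<Sum>j\<in>F. ennreal ((t j * b (\<phi> j) x)\<^sup>2)) \<le>
        (if x \<in> diag_dom b \<phi> t then ennreal ((norm (diag_op b \<phi> t x))\<^sup>2) else \<top>)"
    proof (cases "x \<in> diag_dom b \<phi> t")
      case True
      then have "(\<lambda>j. (t j * b (\<phi> j) x)\<^sup>2) summable_on {1..}"
        by (simp add: diag_dom_def power_mult_distrib)
      from sum_le_norm_infsum_orthonormal[OF on this F] True show ?thesis
        by (simp add: diag_op_def sum_ennreal)
    qed simp
  qed
  finally show ?thesis .
qed

section \<open>Moments of sums of independent random variables\<close>

lemma (in prob_space) integrable_power_of_fourth_moment:
  fixes Z :: "'a \<Rightarrow> real"
  assumes Z: "Z \<in> borel_measurable M" and int: "integrable M (\<lambda>x. Z x ^ 4)" and n: "n \<le> 4"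
  shows "integrable M (\<lambda>x. Z x ^ n)"
proof (rule Bochner_Integration.integrable_bound)
  show "integrable M (\<lambda>x. 1 + Z x ^ 4)"
    using int by simp
  have "\<bar>z\<bar> ^ n \<le> 1 + z ^ 4" for z :: real
  proof (cases "\<bar>z\<bar> \<le> 1")
    case True
    then have "\<bar>z\<bar> ^ n \<le> 1" by (simp add: power_le_one)
    moreover have "0 \<le> z ^ 4" by simp
    ultimately show ?thesis by linarith
  next
    case False
    then have "\<bar>z\<bar> ^ n \<le> \<bar>z\<bar> ^ 4" using n by (intro power_increasing) auto
    then show ?thesis by simp
  qed
  then show "AE x in M. norm (Z x ^ n) \<le> norm (1 + Z x ^ 4)"
    by (auto simp: power_abs abs_of_nonneg add_nonneg_nonneg)
qed (use Z in measurable)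

text \<open>The induction adds one variable at a time: in \<open>(S + Z)\<^sup>4\<close> the terms with an odd power vanish by
centring, which leaves the cross term \<open>6 E S\<^sup>2 E Z\<^sup>2\<close>. Since \<open>6 \<le> 2 K\<close>, this is absorbed by the cross term of
\<open>K (V + v)\<^sup>2\<close>.\<close>

lemma (in prob_space) moments_indep_sum:
  fixes Z :: "'i \<Rightarrow> 'a \<Rightarrow> real"
  assumes "finite I" and "indep_vars (\<lambda>_. borel) Z I"
    and "\<And>i. i \<in> I \<Longrightarrow> integrable M (\<lambda>x. Z i x ^ 4)"
    and "\<And>i. i \<in> I \<Longrightarrow> expectation (Z i) = 0"
    and "\<And>i. i \<in> I \<Longrightarrow> expectation (\<lambda>x. (Z i x)\<^sup>2) = v i"
    and "\<And>i. i \<in> I \<Longrightarrow> expectation (\<lambda>x. Z i x ^ 4) \<le> K * (v i)\<^sup>2"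
    and K: "3 \<le> K"
  shows "integrable M (\<lambda>x. (\<Sum>i\<in>I. Z i x) ^ 4) \<and> expectation (\<lambda>x. \<Sum>i\<in>I. Z i x) = 0 \<and>
    expectation (\<lambda>x. (\<Sum>i\<in>I. Z i x)\<^sup>2) = (\<Sum>i\<in>I. v i) \<and>
    expectation (\<lambda>x. (\<Sum>i\<in>I. Z i x) ^ 4) \<le> K * (\<Sum>i\<in>I. v i)\<^sup>2"
  using assms(1-6)
proof (induction I)
  case empty
  then show ?case by simp
next
  case (insert i I)
  define S where "S x = (\<Sum>i\<in>I. Z i x)" for x
  define V where "V = (\<Sum>i\<in>I. v i)"
  have indep: "indep_var borel (Z i) borel S"
    using indep_vars_sum[OF insert.hyps insert.prems(1)] by (simp add: S_def[abs_def])
  have IH: "integrable M (\<lambda>x. S x ^ 4)" "expectation S = 0" "expectation (\<lambda>x. (S x)\<^sup>2) = V"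
    "expectation (\<lambda>x. S x ^ 4) \<le> K * V\<^sup>2"
    using insert.IH insert.prems indep_vars_subset[OF insert.prems(1), of I]
    by (auto simp: S_def[abs_def] V_def)
  have Zi: "integrable M (\<lambda>x. Z i x ^ 4)" "expectation (Z i) = 0" "expectation (\<lambda>x. (Z i x)\<^sup>2) = v i"
    "expectation (\<lambda>x. Z i x ^ 4) \<le> K * (v i)\<^sup>2"
    using insert.prems by auto
  have meas: "S \<in> borel_measurable M" "Z i \<in> borel_measurable M"
    using indep indep_var_rv1 indep_var_rv2 by blast+
  have intS: "integrable M (\<lambda>x. S x ^ n)" and intZ: "integrable M (\<lambda>x. Z i x ^ n)" if "n \<le> 4" for n
    using integrable_power_of_fourth_moment meas IH(1) Zi(1) that by auto
  have pair: "integrable M (\<lambda>x. S x ^ m * Z i x ^ n)"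
    "expectation (\<lambda>x. S x ^ m * Z i x ^ n) = expectation (\<lambda>x. S x ^ m) * expectation (\<lambda>x. Z i x ^ n)"
    if "m \<le> 4" "n \<le> 4" for m n
  proof -
    have "indep_var borel (\<lambda>x. Z i x ^ n) borel (\<lambda>x. S x ^ m)"
      using indep_var_compose[OF indep, of "\<lambda>x. x ^ n" borel "\<lambda>x. x ^ m" borel] by (simp add: comp_def)
    from indep_var_integrable[OF this] indep_var_lebesgue_integral[OF this] intS intZ that
    show "integrable M (\<lambda>x. S x ^ m * Z i x ^ n)"
      "expectation (\<lambda>x. S x ^ m * Z i x ^ n) = expectation (\<lambda>x. S x ^ m) * expectation (\<lambda>x. Z i x ^ n)"
      by (auto simp: mult.commute)
  qed
  have V: "0 \<le> V" "0 \<le> v i"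
    unfolding IH(3)[symmetric] Zi(3)[symmetric] by (auto intro!: integral_nonneg)
  \<comment> \<open>The powers \<open>0\<close> and \<open>1\<close> are kept explicit so that every summand is an instance of the factorisation.\<close>
  have e4: "(S x + Z i x) ^ 4 = S x ^ 4 * Z i x ^ 0 + 4 * (S x ^ 3 * Z i x ^ 1) + 6 * (S x ^ 2 * Z i x ^ 2)
      + 4 * (S x ^ 1 * Z i x ^ 3) + S x ^ 0 * Z i x ^ 4" for x
    by (simp add: power4_eq_xxxx power3_eq_cube power2_eq_square algebra_simps)
  have e2: "(S x + Z i x)\<^sup>2 = S x ^ 2 * Z i x ^ 0 + 2 * (S x ^ 1 * Z i x ^ 1) + S x ^ 0 * Z i x ^ 2" for x
    by (simp add: power2_eq_square algebra_simps)
  have one: "expectation (\<lambda>x. S x ^ 0) = 1" "expectation (\<lambda>x. Z i x ^ 0) = 1"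
    "expectation (\<lambda>x. S x ^ 1) = 0" "expectation (\<lambda>x. Z i x ^ 1) = 0"
    using IH(2) Zi(2) by (simp_all add: prob_space)
  have "integrable M (\<lambda>x. (S x + Z i x) ^ 4) \<and> expectation (\<lambda>x. (S x + Z i x) ^ 4) =
      expectation (\<lambda>x. S x ^ 4 * Z i x ^ 0) + 4 * expectation (\<lambda>x. S x ^ 3 * Z i x ^ 1)
      + 6 * expectation (\<lambda>x. S x ^ 2 * Z i x ^ 2) + 4 * expectation (\<lambda>x. S x ^ 1 * Z i x ^ 3)
      + expectation (\<lambda>x. S x ^ 0 * Z i x ^ 4)"
    unfolding e4 using pair(1)[of 4 0] pair(1)[of 3 1] pair(1)[of 2 2] pair(1)[of 1 3] pair(1)[of 0 4]
    by (simp del: power_0 power_Suc0_right One_nat_def power_one_right)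
  then have i4: "integrable M (\<lambda>x. (S x + Z i x) ^ 4)"
    and E4: "expectation (\<lambda>x. (S x + Z i x) ^ 4) =
      expectation (\<lambda>x. S x ^ 4) + 6 * V * v i + expectation (\<lambda>x. Z i x ^ 4)"
    using pair(2)[of 4 0] pair(2)[of 3 1] pair(2)[of 2 2] pair(2)[of 1 3] pair(2)[of 0 4] one IH(3) Zi(3)
    by simp_all
  have "expectation (\<lambda>x. (S x + Z i x)\<^sup>2) = expectation (\<lambda>x. S x ^ 2 * Z i x ^ 0)
      + 2 * expectation (\<lambda>x. S x ^ 1 * Z i x ^ 1) + expectation (\<lambda>x. S x ^ 0 * Z i x ^ 2)"
    unfolding e2 using pair(1)[of 2 0] pair(1)[of 1 1] pair(1)[of 0 2]
    by (simp del: power_0 power_Suc0_right One_nat_def power_one_right)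
  then have E2: "expectation (\<lambda>x. (S x + Z i x)\<^sup>2) = V + v i"
    using pair(2)[of 2 0] pair(2)[of 1 1] pair(2)[of 0 2] one IH(3) Zi(3)
    by simp
  have "expectation (\<lambda>x. (S x + Z i x) ^ 4) \<le> K * V\<^sup>2 + 6 * V * v i + K * (v i)\<^sup>2"
    using E4 IH(4) Zi(4) by simp
  also have "\<dots> \<le> K * (V + v i)\<^sup>2"
    using mult_right_mono[OF K mult_nonneg_nonneg[OF V]] by (simp add: power2_eq_square algebra_simps)
  finally have "expectation (\<lambda>x. (S x + Z i x) ^ 4) \<le> K * (V + v i)\<^sup>2" .
  moreover have "expectation (\<lambda>x. S x + Z i x) = 0"
    using intS[of 1] intZ[of 1] IH(2) Zi(2) by simp
  ultimately show ?case
    using insert.hyps i4 E2 by (simp add: S_def V_def add.commute)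
qed

section \<open>Coordinates of product measures and the Gaussian laws\<close>

lemma nn_integral_PiM_component:
  assumes "\<And>i. i \<in> I \<Longrightarrow> prob_space (M i)" "i \<in> I" and f: "f \<in> borel_measurable (M i)"
  shows "(\<integral>\<^sup>+\<omega>. f (\<omega> i) \<partial>PiM I M) = (\<integral>\<^sup>+x. f x \<partial>M i)"
proof -
  have "(\<integral>\<^sup>+x. f x \<partial>M i) = (\<integral>\<^sup>+x. f x \<partial>distr (PiM I M) (M i) (\<lambda>\<omega>. \<omega> i))"
    using distr_PiM_component[of I M i] assms by simp
  also have "\<dots> = (\<integral>\<^sup>+\<omega>. f (\<omega> i) \<partial>PiM I M)"
    using assms by (intro nn_integral_distr) auto
  finally show ?thesis by simp
qed

lemma integral_PiM_component:
  fixes f :: "_ \<Rightarrow> real"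
  assumes "\<And>i. i \<in> I \<Longrightarrow> prob_space (M i)" "i \<in> I" and f: "integrable (M i) f"
  shows "integrable (PiM I M) (\<lambda>\<omega>. f (\<omega> i))" "(\<integral>\<omega>. f (\<omega> i) \<partial>PiM I M) = (\<integral>x. f x \<partial>M i)"
proof -
  have d: "distr (PiM I M) (M i) (\<lambda>\<omega>. \<omega> i) = M i"
    using distr_PiM_component[of I M i] assms by simp
  have m: "(\<lambda>\<omega>. \<omega> i) \<in> measurable (PiM I M) (M i)" "f \<in> borel_measurable (M i)"
    using assms by auto
  show "integrable (PiM I M) (\<lambda>\<omega>. f (\<omega> i))"
    using integrable_distr_eq[OF m] f by (simp add: d)
  show "(\<integral>\<omega>. f (\<omega> i) \<partial>PiM I M) = (\<integral>x. f x \<partial>M i)"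
    using integral_distr[OF m] by (simp add: d)
qed

lemma indep_vars_PiM_coordinates:
  assumes P: "\<And>i. i \<in> I \<Longrightarrow> prob_space (M i)" and "I \<noteq> {}"
  shows "prob_space.indep_vars (PiM I M) M (\<lambda>i \<omega>. \<omega> i) I"
proof -
  interpret prob_space "PiM I M" by (rule prob_space_PiM[OF P])
  have "(\<Pi>\<^sub>M i\<in>I. distr (PiM I M) (M i) (\<lambda>\<omega>. \<omega> i)) = PiM I M"
    by (intro PiM_cong refl distr_PiM_component P)
  moreover have "distr (PiM I M) (PiM I M) (\<lambda>\<omega>. \<lambda>i\<in>I. \<omega> i) = PiM I M"
    using P distr_PiM_reindex[where K=I and I=I and f="\<lambda>i. i" and M=M] by simp
  ultimately have "distr (PiM I M) (PiM I M) (\<lambda>\<omega>. \<lambda>i\<in>I. \<omega> i) =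
      (\<Pi>\<^sub>M i\<in>I. distr (PiM I M) (M i) (\<lambda>\<omega>. \<omega> i))"
    by simp
  then show ?thesis
    using \<open>I \<noteq> {}\<close> by (subst indep_vars_iff_distr_eq_PiM') auto
qed

lemma ennreal_integral_le_nn_integral:
  fixes f :: "'a \<Rightarrow> real"
  assumes "integrable M f"
  shows "ennreal (\<integral>x. f x \<partial>M) \<le> (\<integral>\<^sup>+x. ennreal (f x) \<partial>M)"
proof -
  have "(\<integral>x. f x \<partial>M) \<le> (\<integral>x. max 0 (f x) \<partial>M)"
    using assms by (intro integral_mono) auto
  then have "ennreal (\<integral>x. f x \<partial>M) \<le> ennreal (\<integral>x. max 0 (f x) \<partial>M)"
    by (rule ennreal_leI)
  also have "\<dots> = (\<integral>\<^sup>+x. ennreal (max 0 (f x)) \<partial>M)"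
    using assms by (intro nn_integral_eq_integral[symmetric]) auto
  also have "\<dots> = (\<integral>\<^sup>+x. ennreal (f x) \<partial>M)"
    by (intro nn_integral_cong) (simp add: max_def ennreal_neg)
  finally show ?thesis .
qed

lemma sets_gaussian [measurable_cong, simp]: "sets (gaussian m v) = sets borel"
  by (simp add: gaussian_def)

lemma prob_space_gaussian: "0 < v \<Longrightarrow> prob_space (gaussian m v)"
  unfolding gaussian_def by (rule prob_space_normal_density) simp

lemma gaussian_mean:
  assumes "0 < v"
  shows "integrable (gaussian m v) (\<lambda>x. x)" "(\<integral>x. x \<partial>gaussian m v) = m"
  using assms integrable_normal_moment_nz_1[of "sqrt v" m] integral_normal_moment_nz_1[of "sqrt v" m]
  unfolding gaussian_def by (simp_all add: integrable_density integral_density)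

lemma std_gaussian_moments:
  "integrable (gaussian 0 1) (\<lambda>x. x ^ 4)" "(\<integral>x. x\<^sup>2 \<partial>gaussian 0 1) = 1"
  "(\<integral>x. x ^ 4 \<partial>gaussian 0 1) = 3"
  using integrable_std_normal_moment[of 4] integral_std_normal_moment_even[of 1]
    integral_std_normal_moment_even[of 2]
  unfolding gaussian_def
  by (simp_all add: integrable_density integral_density fact_numeral)

text \<open>Jensen's inequality for the square, through its tangent \<open>h\<close> at the mean.\<close>

lemma nn_integral_sq_gaussian_ge:
  assumes "0 < v"
  shows "ennreal ((u - m)\<^sup>2) \<le> (\<integral>\<^sup>+x. ennreal ((u - x)\<^sup>2) \<partial>gaussian m v)"
proof -
  interpret prob_space "gaussian m v" by (rule prob_space_gaussian[OF assms])
  define h where "h x = (u - m)\<^sup>2 + 2 * (u - m) * m - 2 * (u - m) * x" for x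
  have h: "integrable (gaussian m v) h" "(\<integral>x. h x \<partial>gaussian m v) = (u - m)\<^sup>2"
    using gaussian_mean[OF assms, of m] by (simp_all add: h_def[abs_def] prob_space)
  have "(u - x)\<^sup>2 - h x = (m - x)\<^sup>2" for x
    by (simp add: h_def power2_eq_square algebra_simps)
  then have le: "h x \<le> (u - x)\<^sup>2" for x
    by (metis diff_ge_0_iff_ge zero_le_power2)
  have "ennreal ((u - m)\<^sup>2) \<le> (\<integral>\<^sup>+x. ennreal (h x) \<partial>gaussian m v)"
    using ennreal_integral_le_nn_integral[OF h(1)] by (simp add: h(2))
  also have "\<dots> \<le> (\<integral>\<^sup>+x. ennreal ((u - x)\<^sup>2) \<partial>gaussian m v)"
    by (intro nn_integral_mono ennreal_leI le)
  finally show ?thesis .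
qed

text \<open>Averaging over the noise at fixed design: the \<open>j\<close>-th row of the noise consists of independent standard normal
variables, so a linear combination has mean zero and variance \<open>\<Sum> c\<^sub>n\<^sup>2\<close>.\<close>

lemma nn_integral_noise_sq:
  assumes j: "1 \<le> j" and N: "1 \<le> N"
  shows "(\<integral>\<^sup>+\<xi>. ennreal ((u - (\<Sum>n=1..N. c n * \<xi> (j, n)))\<^sup>2) \<partial>noise_law N) =
    ennreal (u\<^sup>2 + (\<Sum>n=1..N. (c n)\<^sup>2))"
proof -
  let ?I = "{1::nat..} \<times> {1..N}" and ?J = "{j} \<times> {1..N}"
  have P: "prob_space (gaussian 0 1)" by (rule prob_space_gaussian) simp
  interpret prob_space "noise_law N"
    unfolding noise_law_def by (rule prob_space_PiM[OF P])
  define Z where "Z = (\<lambda>i (\<xi> :: nat \<times> nat \<Rightarrow> real). c (snd i) * \<xi> i)"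
  have "indep_vars (\<lambda>_. gaussian 0 1) (\<lambda>i \<xi>. \<xi> i) ?I"
    using indep_vars_PiM_coordinates[of ?I "\<lambda>_. gaussian 0 1"] P N unfolding noise_law_def by auto
  then have "indep_vars (\<lambda>_. gaussian 0 1) (\<lambda>i \<xi>. \<xi> i) ?J"
    by (rule indep_vars_subset) (use j in auto)
  then have indep: "indep_vars (\<lambda>_. borel) Z ?J"
    unfolding Z_def by (rule indep_vars_compose2) simp
  have coord: "integrable (noise_law N) (\<lambda>\<xi>. f (\<xi> i))"
    "expectation (\<lambda>\<xi>. f (\<xi> i)) = (\<integral>x. f x \<partial>gaussian 0 1)"
    if "i \<in> ?J" "integrable (gaussian 0 1) f" for i and f :: "real \<Rightarrow> real"
    using integral_PiM_component[of ?I "\<lambda>_. gaussian 0 1" i f] that P j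
    unfolding noise_law_def by auto
  have sq: "integrable (gaussian 0 1) (\<lambda>x. x\<^sup>2)"
    using prob_space.integrable_power_of_fourth_moment[OF P, of "\<lambda>x. x" 2] std_gaussian_moments(1) by simp
  have "finite ?J" by simp
  have S: "integrable (noise_law N) (\<lambda>\<xi>. (\<Sum>i\<in>?J. Z i \<xi>) ^ 4) \<and> expectation (\<lambda>\<xi>. \<Sum>i\<in>?J. Z i \<xi>) = 0 \<and>
    expectation (\<lambda>\<xi>. (\<Sum>i\<in>?J. Z i \<xi>)\<^sup>2) = (\<Sum>i\<in>?J. (c (snd i))\<^sup>2) \<and>
    expectation (\<lambda>\<xi>. (\<Sum>i\<in>?J. Z i \<xi>) ^ 4) \<le> 3 * (\<Sum>i\<in>?J. (c (snd i))\<^sup>2)\<^sup>2"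
    using coord[OF _ gaussian_mean(1)] coord[OF _ sq] coord[OF _ std_gaussian_moments(1)]
    by (intro moments_indep_sum[OF \<open>finite ?J\<close> indep])
       (auto simp: Z_def power_mult_distrib gaussian_mean std_gaussian_moments)
  have sum_J: "(\<Sum>i\<in>?J. f i) = (\<Sum>n=1..N. f (j, n))" for f :: "nat \<times> nat \<Rightarrow> real"
    using sum.cartesian_product[of "\<lambda>i n. f (i, n)" "{1..N}" "{j}"] by simp
  define T where "T \<xi> = (\<Sum>n=1..N. c n * \<xi> (j, n))" for \<xi> :: "nat \<times> nat \<Rightarrow> real"
  have T: "integrable (noise_law N) (\<lambda>\<xi>. T \<xi> ^ 4)" "expectation T = 0"
    "expectation (\<lambda>\<xi>. (T \<xi>)\<^sup>2) = (\<Sum>n=1..N. (c n)\<^sup>2)"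
    using S unfolding sum_J Z_def T_def[abs_def] by auto
  have meas: "T \<in> borel_measurable (noise_law N)"
    using indep unfolding T_def[abs_def] indep_vars_def Z_def by (auto intro!: borel_measurable_sum)
  have int: "integrable (noise_law N) T" "integrable (noise_law N) (\<lambda>\<xi>. (T \<xi>)\<^sup>2)"
    using integrable_power_of_fourth_moment[OF meas T(1), of 1]
      integrable_power_of_fourth_moment[OF meas T(1), of 2] by auto
  have eq: "(u - t)\<^sup>2 = u\<^sup>2 - 2 * u * t + t\<^sup>2" for t
    by (simp add: power2_eq_square algebra_simps)
  have "(\<integral>\<^sup>+\<xi>. ennreal ((u - T \<xi>)\<^sup>2) \<partial>noise_law N) = ennreal (expectation (\<lambda>\<xi>. (u - T \<xi>)\<^sup>2))"
  proof (intro nn_integral_eq_integral)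
    show "integrable (noise_law N) (\<lambda>\<xi>. (u - T \<xi>)\<^sup>2)"
      unfolding eq using int by simp
  qed simp
  also have "expectation (\<lambda>\<xi>. (u - T \<xi>)\<^sup>2) = u\<^sup>2 + (\<Sum>n=1..N. (c n)\<^sup>2)"
    unfolding eq using int T by (simp add: prob_space)
  finally show ?thesis by (simp add: T_def)
qed

section \<open>Fourth moments under a Karhunen-Loeve expansion\<close>

lemma bigo_1_imp_bounded:
  fixes f :: "nat \<Rightarrow> real"
  assumes "f \<in> O(\<lambda>_. 1)"
  obtains K where "\<And>k. f k \<le> K"
proof -
  from assms obtain c where "eventually (\<lambda>k. \<bar>f k\<bar> \<le> c) sequentially"
    by (auto elim!: landau_o.bigE)
  then obtain n where n: "\<And>k. n \<le> k \<Longrightarrow> \<bar>f k\<bar> \<le> c"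
    by (auto simp: eventually_sequentially)
  have "f k \<le> max c (Max (f ` {..n}))" for k
  proof (cases "n \<le> k")
    case True
    then show ?thesis using n[OF True] by simp
  next
    case False
    then have "f k \<le> Max (f ` {..n})" by (intro Max_ge) auto
    then show ?thesis by simp
  qed
  then show thesis by (rule that)
qed

text \<open>Let \<open>w\<close> be the orthogonal projection of \<open>u\<close> onto the span of finitely many eigenvectors. That span is
invariant under \<open>\<Lambda>\<close>, so the mixed terms vanish in \<open>\<langle>u - w, \<Lambda>(u - w)\<rangle> \<ge> 0\<close>, and the left-hand side
is \<open>\<langle>w, \<Lambda> w\<rangle>\<close>.\<close>

lemma spectral_sum_le_quadratic_form:
  fixes \<Lambda> :: "'h::real_inner \<Rightarrow> 'h"
  assumes lin: "bounded_linear \<Lambda>" and sym: "\<And>u v. u \<bullet> \<Lambda> v = v \<bullet> \<Lambda> u"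
    and pos: "\<And>u. 0 \<le> u \<bullet> \<Lambda> u"
    and on: "\<And>i j. i \<in> F \<Longrightarrow> j \<in> F \<Longrightarrow> \<psi> i \<bullet> \<psi> j = (if i = j then 1 else 0)"
    and eig: "\<And>k. k \<in> F \<Longrightarrow> \<Lambda> (\<psi> k) = \<mu> k *\<^sub>R \<psi> k" and F: "finite F"
  shows "(\<Sum>k\<in>F. \<mu> k * (u \<bullet> \<psi> k)\<^sup>2) \<le> u \<bullet> \<Lambda> u"
proof -
  interpret bounded_linear \<Lambda> by (rule lin)
  define w where "w = (\<Sum>k\<in>F. (u \<bullet> \<psi> k) *\<^sub>R \<psi> k)"
  have w: "w \<bullet> \<psi> k = u \<bullet> \<psi> k" if "k \<in> F" for k
  proof -
    have "w \<bullet> \<psi> k = (\<Sum>i\<in>F. if i = k then u \<bullet> \<psi> i else 0)"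
      unfolding w_def inner_sum_left using that by (intro sum.cong) (auto simp: on)
    then show ?thesis using that F by simp
  qed
  have Lw: "\<Lambda> w = (\<Sum>k\<in>F. (u \<bullet> \<psi> k * \<mu> k) *\<^sub>R \<psi> k)"
    unfolding w_def sum scaleR by (intro sum.cong) (auto simp: eig)
  have inner_Lw: "v \<bullet> \<Lambda> w = (\<Sum>k\<in>F. (u \<bullet> \<psi> k * \<mu> k) * (v \<bullet> \<psi> k))" for v
    by (simp add: Lw inner_sum_right)
  have cross: "u \<bullet> \<Lambda> w = w \<bullet> \<Lambda> w"
    unfolding inner_Lw by (intro sum.cong) (auto simp: w)
  have "(u - w) \<bullet> \<Lambda> (u - w) = u \<bullet> \<Lambda> u - u \<bullet> \<Lambda> w"
    using cross sym[of w u] by (simp add: diff inner_diff_left inner_diff_right)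
  then have "u \<bullet> \<Lambda> w \<le> u \<bullet> \<Lambda> u"
    using pos[of "u - w"] by simp
  then show ?thesis
    by (simp add: inner_Lw power2_eq_square mult_ac)
qed

text \<open>The constant is uniform over all directions \<open>u\<close>. It is at least \<open>3\<close> and at least every \<open>E \<zeta>\<^sub>k\<^sup>4\<close>: the partial sums of
\<open>\<langle>u, x\<rangle> = \<Sum>k. \<lambda>\<^sub>k \<langle>u, \<psi>\<^sub>k\<rangle> \<zeta>\<^sub>k\<close> are sums of independent centred variables whose variance is at most
\<open>\<langle>u, \<Lambda> u\<rangle>\<close>.\<close>

lemma fourth_moment_le_of_karhunen_loeve:
  fixes \<nu> :: "'h::{real_inner, banach, second_countable_topology} measure"
  assumes prob: "prob_space \<nu>" and sets: "sets \<nu> = sets borel"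
    and cov: "covariance_wrt inner \<nu> \<Lambda>" and KL: "karhunen_loeve_condition \<nu> \<Lambda>"
  obtains K where "1 \<le> K"
    "\<And>u. integrable \<nu> (\<lambda>x. (u \<bullet> x) ^ 4)"
    "\<And>u. (\<integral>x. (u \<bullet> x) ^ 4 \<partial>\<nu>) \<le> K * (u \<bullet> \<Lambda> u)\<^sup>2"
proof -
  interpret prob_space \<nu> by (rule prob)
  note [measurable_cong] = sets
  from KL obtain \<psi> lam \<zeta> where basis: "orthonormal_basis \<psi>"
    and eig: "\<And>k. 1 \<le> k \<Longrightarrow> \<Lambda> (\<psi> k) = (lam k)\<^sup>2 *\<^sub>R \<psi> k"
    and expand: "AE x in \<nu>. ((\<lambda>k. (lam k * \<zeta> k x) *\<^sub>R \<psi> k) has_sum x) {1..}"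
    and indep: "indep_vars (\<lambda>_. borel) \<zeta> {1..}"
    and int4: "\<And>k. 1 \<le> k \<Longrightarrow> integrable \<nu> (\<lambda>x. \<zeta> k x ^ 4)"
    and mean: "\<And>k. 1 \<le> k \<Longrightarrow> expectation (\<zeta> k) = 0"
    and var: "\<And>k. 1 \<le> k \<Longrightarrow> expectation (\<lambda>x. (\<zeta> k x)\<^sup>2) = 1"
    and bigo: "(\<lambda>k. expectation (\<lambda>x. \<zeta> k x ^ 4)) \<in> O(\<lambda>_. 1)"
    unfolding karhunen_loeve_condition_def by blast
  obtain K0 where K0: "\<And>k. expectation (\<lambda>x. \<zeta> k x ^ 4) \<le> K0"
    using bigo_1_imp_bounded[OF bigo] by blast
  define K where "K = max 3 K0"
  have K: "3 \<le> K" "expectation (\<lambda>x. \<zeta> k x ^ 4) \<le> K" for k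
    using K0[of k] by (auto simp: K_def)
  have quad: "u \<bullet> \<Lambda> v = (\<integral>x. (u \<bullet> x) * (v \<bullet> x) \<partial>\<nu>)" "bounded_linear \<Lambda>" for u v
    using cov by (auto simp: covariance_wrt_def)
  have spectral: "(\<Sum>k=1..n. (lam k)\<^sup>2 * (u \<bullet> \<psi> k)\<^sup>2) \<le> u \<bullet> \<Lambda> u" for u n
    using basis
    by (intro spectral_sum_le_quadratic_form quad(2) eig)
       (auto simp: quad(1) mult.commute orthonormal_basis_def)
  have main: "(\<integral>\<^sup>+x. ennreal ((u \<bullet> x) ^ 4) \<partial>\<nu>) \<le> ennreal (K * (u \<bullet> \<Lambda> u)\<^sup>2)" for u
  proof -
    define Z where "Z = (\<lambda>k x. (lam k * (u \<bullet> \<psi> k)) * \<zeta> k x)"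
    define S where "S n x = (\<Sum>k=1..n. Z k x)" for n x
    have part: "(\<integral>\<^sup>+x. ennreal (S n x ^ 4) \<partial>\<nu>) \<le> ennreal (K * (u \<bullet> \<Lambda> u)\<^sup>2)" for n
    proof -
      have iZ: "indep_vars (\<lambda>_. borel) Z {1..n}"
        unfolding Z_def by (rule indep_vars_compose2[OF indep_vars_subset[OF indep]]) auto
      have "finite {1..n}" by simp
      have S: "integrable \<nu> (\<lambda>x. (\<Sum>k=1..n. Z k x) ^ 4) \<and> expectation (\<lambda>x. \<Sum>k=1..n. Z k x) = 0 \<and>
        expectation (\<lambda>x. (\<Sum>k=1..n. Z k x)\<^sup>2) = (\<Sum>k=1..n. (lam k * (u \<bullet> \<psi> k))\<^sup>2) \<and>
        expectation (\<lambda>x. (\<Sum>k=1..n. Z k x) ^ 4) \<le> K * (\<Sum>k=1..n. (lam k * (u \<bullet> \<psi> k))\<^sup>2)\<^sup>2"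
      proof (rule moments_indep_sum[OF \<open>finite {1..n}\<close> iZ _ _ _ _ K(1)])
        fix k assume k: "k \<in> {1..n}"
        show "integrable \<nu> (\<lambda>x. Z k x ^ 4)"
          using int4[of k] k by (simp add: Z_def power_mult_distrib)
        show "expectation (Z k) = 0"
          using mean[of k] k by (simp add: Z_def)
        show "expectation (\<lambda>x. (Z k x)\<^sup>2) = (lam k * (u \<bullet> \<psi> k))\<^sup>2"
          using var[of k] k by (simp add: Z_def power_mult_distrib)
        have "expectation (\<lambda>x. Z k x ^ 4) = (lam k * (u \<bullet> \<psi> k)) ^ 4 * expectation (\<lambda>x. \<zeta> k x ^ 4)"
          unfolding Z_def power_mult_distrib[of _ "\<zeta> k _"] by simp
        also have "\<dots> \<le> (lam k * (u \<bullet> \<psi> k)) ^ 4 * K"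
          by (intro mult_left_mono K) simp
        finally show "expectation (\<lambda>x. Z k x ^ 4) \<le> K * ((lam k * (u \<bullet> \<psi> k))\<^sup>2)\<^sup>2"
          by (simp add: mult.commute flip: power_mult)
      qed
      have "expectation (\<lambda>x. S n x ^ 4) \<le> K * (\<Sum>k=1..n. (lam k * (u \<bullet> \<psi> k))\<^sup>2)\<^sup>2"
        using S by (simp add: S_def)
      also have "\<dots> \<le> K * (u \<bullet> \<Lambda> u)\<^sup>2"
        using spectral[of u n] K(1)
        by (intro mult_left_mono power_mono) (auto simp: power_mult_distrib intro!: sum_nonneg)
      finally have "ennreal (expectation (\<lambda>x. S n x ^ 4)) \<le> ennreal (K * (u \<bullet> \<Lambda> u)\<^sup>2)"
        by (rule ennreal_leI)
      moreover have "(\<integral>\<^sup>+x. ennreal (S n x ^ 4) \<partial>\<nu>) = ennreal (expectation (\<lambda>x. S n x ^ 4))"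
        using S by (intro nn_integral_eq_integral) (auto simp: S_def)
      ultimately show ?thesis by simp
    qed
    have conv: "AE x in \<nu>. (\<lambda>n. ennreal (S n x ^ 4)) \<longlonglongrightarrow> ennreal ((u \<bullet> x) ^ 4)"
      using expand
    proof eventually_elim
      case (elim x)
      have "((\<lambda>k. u \<bullet> ((lam k * \<zeta> k x) *\<^sub>R \<psi> k)) has_sum (u \<bullet> x)) {1..}"
        by (rule has_sum_bounded_linear[OF bounded_linear_inner_right elim])
      then have "((\<lambda>k. Z k x) has_sum (u \<bullet> x)) {1..}"
        by (simp add: Z_def mult_ac)
      then have lim: "(sum (\<lambda>k. Z k x) \<longlongrightarrow> u \<bullet> x) (finite_subsets_at_top {1..})"
        by (simp add: has_sum_def)
      \<comment> \<open>Convergence along all finite index sets is specialised to the initial segments.\<close>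
      have "filterlim (\<lambda>n. {1..n}) (finite_subsets_at_top {1::nat..}) sequentially"
        unfolding filterlim_finite_subsets_at_top
      proof (intro allI impI)
        fix X :: "nat set" assume X: "finite X \<and> X \<subseteq> {1..}"
        show "\<forall>\<^sub>F n in sequentially. finite {1..n} \<and> X \<subseteq> {1..n} \<and> {1..n} \<subseteq> {1..}"
          using eventually_ge_at_top[of "Max X"]
        proof eventually_elim
          case (elim n)
          then have "x \<le> n" if "x \<in> X" for x
            using order_trans[OF Max_ge[of X x]] X that by blast
          then show ?case using X by (auto simp: subset_iff)
        qed
      qed
      from filterlim_compose[OF lim this] have "(\<lambda>n. S n x) \<longlonglongrightarrow> u \<bullet> x"
        by (simp add: S_def[abs_def])
      then show ?case by (intro tendsto_ennrealI tendsto_power)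
    qed
    have rv: "random_variable borel (\<zeta> k)" if "1 \<le> k" for k
      using indep that by (auto simp: indep_vars_def)
    have meas: "S n \<in> borel_measurable \<nu>" for n
      unfolding S_def[abs_def] Z_def
      by (intro borel_measurable_sum borel_measurable_times borel_measurable_const rv) auto
    have "(\<integral>\<^sup>+x. ennreal ((u \<bullet> x) ^ 4) \<partial>\<nu>) = (\<integral>\<^sup>+x. liminf (\<lambda>n. ennreal (S n x ^ 4)) \<partial>\<nu>)"
    proof (intro nn_integral_cong_AE eventually_mono[OF conv])
      show "ennreal ((u \<bullet> x) ^ 4) = liminf (\<lambda>n. ennreal (S n x ^ 4))"
        if "(\<lambda>n. ennreal (S n x ^ 4)) \<longlonglongrightarrow> ennreal ((u \<bullet> x) ^ 4)" for x
        using lim_imp_Liminf[OF _ that] by simp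
    qed
    also have "\<dots> \<le> liminf (\<lambda>n. \<integral>\<^sup>+x. ennreal (S n x ^ 4) \<partial>\<nu>)"
      using meas by (intro nn_integral_liminf) auto
    also have "\<dots> \<le> ennreal (K * (u \<bullet> \<Lambda> u)\<^sup>2)"
      using part by (intro Liminf_le) (auto intro!: always_eventually)
    finally show ?thesis .
  qed
  have int: "integrable \<nu> (\<lambda>x. (u \<bullet> x) ^ 4)" for u
    using main[of u] by (intro integrableI_bounded) (auto simp: le_less_trans[OF _ ennreal_less_top])
  have "(\<integral>x. (u \<bullet> x) ^ 4 \<partial>\<nu>) \<le> K * (u \<bullet> \<Lambda> u)\<^sup>2" for u
    using main[of u] K(1) int[of u] by (subst (asm) nn_integral_eq_integral) auto
  with K(1) int show thesis by (intro that[of K]) auto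
qed

section \<open>Error of the posterior mean in one coordinate\<close>

text \<open>The left-hand side is the tangent of the convex function \<open>z \<mapsto> 1/z\<^sup>2\<close> at \<open>m\<close>; the difference has the factor
\<open>(m - z)\<^sup>2 (m + 2 z)\<close>.\<close>

lemma inverse_square_ge_tangent:
  fixes z m :: real
  assumes "0 < z" "0 < m"
  shows "3 / m\<^sup>2 - 2 * z / m ^ 3 \<le> 1 / z\<^sup>2"
proof -
  have "0 \<le> (m - z)\<^sup>2 * (m + 2 * z)"
    using assms by simp
  also have "\<dots> = m ^ 3 - (3 * m - 2 * z) * z\<^sup>2"
    by (simp add: power2_eq_square power3_eq_cube algebra_simps)
  finally have "(3 * m - 2 * z) / m ^ 3 \<le> 1 / z\<^sup>2"
    using assms by (simp add: field_simps)
  moreover have "(3 * m - 2 * z) / m ^ 3 = 3 / m\<^sup>2 - 2 * z / m ^ 3"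
    using assms by (simp add: field_simps power2_eq_square power3_eq_cube)
  ultimately show ?thesis by simp
qed

text \<open>A pointwise form of the Paley-Zygmund argument. If \<open>G \<le> M \<theta>\<close>, the denominator is at most its value at
\<open>\<theta>\<close> times \<open>(1 + M)\<^sup>2\<close>; otherwise the left-hand side is not positive. Taking expectations with
\<open>E G = \<theta>\<close> and \<open>E G\<^sup>2 \<le> K \<theta>\<^sup>2\<close>, the numerator on the left keeps the fraction \<open>1 - K / M\<close> of \<open>\<theta>\<close>.\<close>

lemma variance_factor_ge:
  fixes G a \<theta> M :: real
  assumes "0 \<le> G" "0 \<le> a" "0 < \<theta>" "0 < M"
  shows "(G - G\<^sup>2 / (M * \<theta>)) / ((1 + a * \<theta>)\<^sup>2 * (1 + M)\<^sup>2) \<le> G / (1 + a * G)\<^sup>2"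
proof (cases "G \<le> M * \<theta>")
  case True
  have pos: "0 < 1 + a * G" "0 < 1 + a * \<theta>"
    using assms by (auto intro!: add_pos_nonneg)
  have "1 + a * G \<le> 1 + a * (M * \<theta>)"
    using True assms by (simp add: mult_left_mono)
  also have "\<dots> \<le> (1 + a * \<theta>) * (1 + M)"
    using assms by (simp add: algebra_simps)
  finally have "(1 + a * G)\<^sup>2 \<le> ((1 + a * \<theta>) * (1 + M))\<^sup>2"
    using assms by (intro power_mono) auto
  then have "G / ((1 + a * \<theta>)\<^sup>2 * (1 + M)\<^sup>2) \<le> G / (1 + a * G)\<^sup>2"
    using assms pos by (intro divide_left_mono) (auto simp: power_mult_distrib)
  moreover have "(G - G\<^sup>2 / (M * \<theta>)) / ((1 + a * \<theta>)\<^sup>2 * (1 + M)\<^sup>2) \<le> G / ((1 + a * \<theta>)\<^sup>2 * (1 + M)\<^sup>2)"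
    using assms by (intro divide_right_mono) auto
  ultimately show ?thesis by linarith
next
  case False
  then have "G * (M * \<theta>) \<le> G * G"
    using assms by (intro mult_left_mono) auto
  then have "G - G\<^sup>2 / (M * \<theta>) \<le> 0"
    using assms by (simp add: field_simps power2_eq_square)
  then have "(G - G\<^sup>2 / (M * \<theta>)) / ((1 + a * \<theta>)\<^sup>2 * (1 + M)\<^sup>2) \<le> 0"
    by (intro divide_nonpos_nonneg) auto
  also have "0 \<le> G / (1 + a * G)\<^sup>2" using assms by simp
  finally show ?thesis .
qed

text \<open>The signal part of the data multiplies the truth by \<open>a G / (1 + a G)\<close>, which leaves the bias \<open>l / (1 + a G)\<close>; the
rest is linear in the noise.\<close>

lemma posterior_mean_error_eq:
  fixes g y :: "nat \<Rightarrow> real"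
  assumes N: "1 \<le> N" and \<gamma>: "\<gamma> > 0" and G: "G = 1 / real N * (\<Sum>n=1..N. (g n)\<^sup>2)"
    and a: "a = real N * (1 / \<gamma>\<^sup>2) * s" and s: "0 \<le> s"
  shows "l - (a * (1 / real N * (\<Sum>n=1..N. (g n * l + \<gamma> * y n) * g n))) / (1 + a * G) =
    l / (1 + a * G) - (\<Sum>n=1..N. (a * \<gamma> * g n / (real N * (1 + a * G))) * y n)"
proof -
  have "0 \<le> a" "0 \<le> G"
    unfolding a G using s by (simp_all add: sum_nonneg)
  then have D: "0 < 1 + a * G"
    by (intro add_pos_nonneg mult_nonneg_nonneg) auto
  have 1: "(\<Sum>n=1..N. (g n * l + \<gamma> * y n) * g n) = l * (real N * G) + \<gamma> * (\<Sum>n=1..N. g n * y n)"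
    using N unfolding G
    by (simp add: sum.distrib sum_distrib_left power2_eq_square algebra_simps)
  have 2: "(\<Sum>n=1..N. (a * \<gamma> * g n / (real N * (1 + a * G))) * y n) =
      a * \<gamma> / (real N * (1 + a * G)) * (\<Sum>n=1..N. g n * y n)"
    by (simp add: sum_distrib_left sum_divide_distrib mult_ac)
  have 3: "a * (1 / real N * (l * (real N * G) + \<gamma> * T)) = a * G * l + a * \<gamma> / real N * T" for T
    using N by (simp add: field_simps)
  have 4: "l = (l + a * G * l) / (1 + a * G)"
    using D by (simp add: field_simps)
  show ?thesis
    unfolding 1 2 3 by (subst (1) 4) (simp add: add_divide_distrib)
qed

text \<open>A lower bound for bias plus variance that is an average over the design points of a function of one point
each, so that its expectation involves only the law of a single design point. This is why \<open>G\<^sup>2\<close> is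
replaced by the average of the \<open>g\<^sub>n\<^sup>4\<close>.\<close>

lemma mean_error_integrand_ge:
  fixes g :: "nat \<Rightarrow> real"
  assumes N: "1 \<le> N" and a: "0 \<le> a" and \<theta>: "0 < \<theta>" and M: "0 < M"
    and G: "G = 1 / real N * (\<Sum>n=1..N. (g n)\<^sup>2)"
  shows "1 / real N * (\<Sum>n=1..N. l\<^sup>2 * (3 / (1 + a * \<theta>)\<^sup>2 - 2 * (1 + a * (g n)\<^sup>2) / (1 + a * \<theta>) ^ 3) +
       (a * \<gamma>)\<^sup>2 / real N * (((g n)\<^sup>2 - g n ^ 4 / (M * \<theta>)) / ((1 + a * \<theta>)\<^sup>2 * (1 + M)\<^sup>2)))
    \<le> (l / (1 + a * G))\<^sup>2 + (\<Sum>n=1..N. (a * \<gamma> * g n / (real N * (1 + a * G)))\<^sup>2)"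
proof -
  define m where "m = 1 + a * \<theta>"
  define q where "q = (1 + a * \<theta>)\<^sup>2 * (1 + M)\<^sup>2"
  have m: "0 < m" unfolding m_def using a \<theta> by (intro add_pos_nonneg) auto
  have q: "0 < q" unfolding q_def using m M by (auto simp: m_def)
  have Npos: "0 < real N" using N by simp
  have G0: "0 \<le> G" unfolding G by (simp add: sum_nonneg)
  have D: "0 < 1 + a * G" using a G0 by (intro add_pos_nonneg) auto
  have sum_sq: "(\<Sum>n=1..N. (g n)\<^sup>2) = real N * G"
    using Npos by (simp add: G)
  have quartic: "G\<^sup>2 \<le> 1 / real N * (\<Sum>n=1..N. g n ^ 4)"
  proof -
    have "(real N * G)\<^sup>2 \<le> (\<Sum>n=1..N. ((g n)\<^sup>2)\<^sup>2) * real N"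
      using sum_squared_le_sum_of_squares[of "\<lambda>n. (g n)\<^sup>2" "{1..N}"] unfolding sum_sq by simp
    also have "(\<Sum>n=1..N. ((g n)\<^sup>2)\<^sup>2) = (\<Sum>n=1..N. g n ^ 4)"
      by (simp flip: power_mult)
    finally show ?thesis using Npos by (simp add: field_simps power2_eq_square)
  qed
  have "1 / real N * (\<Sum>n=1..N. l\<^sup>2 * (3 / m\<^sup>2 - 2 * (1 + a * (g n)\<^sup>2) / m ^ 3) +
       (a * \<gamma>)\<^sup>2 / real N * (((g n)\<^sup>2 - g n ^ 4 / (M * \<theta>)) / q)) =
     l\<^sup>2 * (3 / m\<^sup>2 - 2 * (1 + a * G) / m ^ 3) +
     (a * \<gamma>)\<^sup>2 / real N * ((G - (1 / real N * (\<Sum>n=1..N. g n ^ 4)) / (M * \<theta>)) / q)"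
  proof -
    have "(\<Sum>n=1..N. l\<^sup>2 * (3 / m\<^sup>2 - 2 * (1 + a * (g n)\<^sup>2) / m ^ 3)) =
        real N * (l\<^sup>2 * (3 / m\<^sup>2 - 2 * (1 + a * G) / m ^ 3))"
    proof -
      have "(\<Sum>n=1..N. l\<^sup>2 * (3 / m\<^sup>2 - 2 * (1 + a * (g n)\<^sup>2) / m ^ 3)) =
          (\<Sum>n=1..N. l\<^sup>2 * (3 / m\<^sup>2 - 2 / m ^ 3) - l\<^sup>2 * 2 * a / m ^ 3 * (g n)\<^sup>2)"
        by (intro sum.cong refl) (simp add: algebra_simps add_divide_distrib diff_divide_distrib)
      also have "\<dots> = real N * (l\<^sup>2 * (3 / m\<^sup>2 - 2 / m ^ 3)) - l\<^sup>2 * 2 * a / m ^ 3 * (real N * G)"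
        by (simp add: sum_subtractf sum_distrib_left[symmetric] sum_divide_distrib[symmetric] sum_sq del: One_nat_def)
      also have "\<dots> = real N * (l\<^sup>2 * (3 / m\<^sup>2 - 2 * (1 + a * G) / m ^ 3))"
        by (simp add: algebra_simps add_divide_distrib diff_divide_distrib)
      finally show ?thesis .
    qed
    moreover have "(\<Sum>n=1..N. (a * \<gamma>)\<^sup>2 / real N * (((g n)\<^sup>2 - g n ^ 4 / (M * \<theta>)) / q)) =
        (a * \<gamma>)\<^sup>2 / real N * ((real N * G - (\<Sum>n=1..N. g n ^ 4) / (M * \<theta>)) / q)"
      by (simp add: sum_distrib_left[symmetric] sum_divide_distrib[symmetric] sum_subtractf sum_sq del: One_nat_def)
    moreover have "real N * G - (\<Sum>n=1..N. g n ^ 4) / (M * \<theta>) =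
        real N * (G - (1 / real N * (\<Sum>n=1..N. g n ^ 4)) / (M * \<theta>))"
      using Npos by (simp add: right_diff_distrib)
    ultimately show ?thesis
      using Npos by (simp add: sum.distrib distrib_left)
  qed
  also have "\<dots> \<le> l\<^sup>2 * (1 / (1 + a * G)\<^sup>2) + (a * \<gamma>)\<^sup>2 / real N * (G / (1 + a * G)\<^sup>2)"
  proof (intro add_mono mult_left_mono)
    show "3 / m\<^sup>2 - 2 * (1 + a * G) / m ^ 3 \<le> 1 / (1 + a * G)\<^sup>2"
      by (rule inverse_square_ge_tangent[OF D m])
    have "(G - (1 / real N * (\<Sum>n=1..N. g n ^ 4)) / (M * \<theta>)) / q \<le> (G - G\<^sup>2 / (M * \<theta>)) / q"
      using quartic q M \<theta> by (intro divide_right_mono diff_left_mono) auto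
    also have "\<dots> \<le> G / (1 + a * G)\<^sup>2"
      unfolding q_def by (rule variance_factor_ge[OF G0 a \<theta> M])
    finally show "(G - (1 / real N * (\<Sum>n=1..N. g n ^ 4)) / (M * \<theta>)) / q \<le> G / (1 + a * G)\<^sup>2" .
  qed (use Npos in auto)
  also have "\<dots> = (l / (1 + a * G))\<^sup>2 + (\<Sum>n=1..N. (a * \<gamma> * g n / (real N * (1 + a * G)))\<^sup>2)"
  proof -
    have "(\<Sum>n=1..N. (a * \<gamma> * g n / (real N * (1 + a * G)))\<^sup>2) =
        (a * \<gamma> / (real N * (1 + a * G)))\<^sup>2 * (\<Sum>n=1..N. (g n)\<^sup>2)"
      by (simp add: sum_distrib_left sum_divide_distrib power_mult_distrib power_divide mult_ac)
    also have "\<dots> = (a * \<gamma>)\<^sup>2 / real N * (G / (1 + a * G)\<^sup>2)"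
      unfolding sum_sq using Npos D
      by (simp add: power_divide power_mult_distrib power2_eq_square mult_ac)
    finally show ?thesis by (simp add: power_divide)
  qed
  finally show ?thesis by (simp add: m_def q_def)
qed

lemma measurable_design_coordinate:
  fixes \<phi> :: "nat \<Rightarrow> 'h::{real_inner, second_countable_topology}"
  assumes sets: "sets \<nu> = sets borel" and n: "n \<in> {1..N}"
  shows "(\<lambda>X. \<phi> j \<bullet> X n) \<in> borel_measurable (design_law \<nu> N)"
proof -
  have "(\<lambda>X. X n) \<in> measurable (design_law \<nu> N) \<nu>"
    unfolding design_law_def using n by (rule measurable_component_singleton)
  moreover have "(\<lambda>x. \<phi> j \<bullet> x) \<in> borel_measurable \<nu>"
    unfolding measurable_cong_sets[OF sets refl] by simp
  ultimately show ?thesis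
    by (rule measurable_compose)
qed

lemma measurable_observe:
  fixes \<phi> :: "nat \<Rightarrow> 'h::{real_inner, second_countable_topology}"
  assumes sets: "sets \<nu> = sets borel"
  shows "observe \<phi> l \<gamma> N \<in> measurable (design_law \<nu> N \<Otimes>\<^sub>M noise_law N)
    (design_law \<nu> N \<Otimes>\<^sub>M (\<Pi>\<^sub>M jn\<in>{1..} \<times> {1..N}. borel))"
  unfolding observe_def case_prod_beta
proof (intro measurable_Pair measurable_fst measurable_restrict)
  fix i :: "nat \<times> nat" assume i: "i \<in> {1..} \<times> {1..N}"
  have "(\<lambda>\<xi>. \<xi> i) \<in> borel_measurable (noise_law N)"
    unfolding noise_law_def using measurable_component_singleton[OF i, of "\<lambda>_. gaussian 0 1"]
    by (simp cong: measurable_cong_sets)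
  moreover have "(\<lambda>X. \<phi> (fst i) \<bullet> X (snd i)) \<in> borel_measurable (design_law \<nu> N)"
    using i by (intro measurable_design_coordinate[OF sets]) auto
  ultimately show "(\<lambda>x. (\<phi> (fst i) \<bullet> fst x (snd i)) * l (fst i) + \<gamma> * snd x (fst i, snd i))
      \<in> borel_measurable (design_law \<nu> N \<Otimes>\<^sub>M noise_law N)"
    by (intro borel_measurable_add borel_measurable_times borel_measurable_const)
      (auto intro: measurable_compose[OF measurable_fst] measurable_compose[OF measurable_snd])
qed

lemma measurable_post_mean:
  fixes \<phi> :: "nat \<Rightarrow> 'h::{real_inner, second_countable_topology}"
  assumes sets: "sets \<nu> = sets borel" and j: "1 \<le> j"
  shows "(\<lambda>D. post_mean \<phi> \<sigma> \<gamma> N D j) \<in> borel_measurable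
    (design_law \<nu> N \<Otimes>\<^sub>M (\<Pi>\<^sub>M jn\<in>{1..} \<times> {1..N}. borel))"
proof -
  let ?M = "design_law \<nu> N \<Otimes>\<^sub>M (\<Pi>\<^sub>M jn\<in>{1..} \<times> {1..N}. (borel :: real measure))"
  have g: "(\<lambda>D. \<phi> j \<bullet> fst D n) \<in> borel_measurable ?M" if "n \<in> {1..N}" for n
    using measurable_compose[OF measurable_fst measurable_design_coordinate[OF sets that]] .
  have y: "(\<lambda>D. snd D (j, n)) \<in> borel_measurable ?M" if "n \<in> {1..N}" for n
    using measurable_compose[OF measurable_snd measurable_component_singleton[of "(j, n)"]] that j
    by auto
  show ?thesis
    unfolding post_mean_def case_prod_beta
    by (intro borel_measurable_divide borel_measurable_add borel_measurable_times
        borel_measurable_const borel_measurable_sum borel_measurable_power g y) auto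
qed

lemma sets_data_law:
  "sets (data_law \<phi> \<nu> l \<gamma> N) = sets (design_law \<nu> N \<Otimes>\<^sub>M (\<Pi>\<^sub>M jn\<in>{1..} \<times> {1..N}. borel))"
  by (simp add: data_law_def)

text \<open>The truncation level is \<open>M = 2 K\<close>: with \<open>E g\<^sup>4 \<le> K \<theta>\<^sup>2\<close> half of \<open>\<theta>\<close> survives in the variance term. In
the bias term the linear part of the tangent averages to its value at \<open>\<theta>\<close>.\<close>

lemma coordinate_error_ge:
  fixes \<phi> :: "nat \<Rightarrow> 'h::{real_inner, banach, second_countable_topology}"
  assumes prob: "prob_space \<nu>" and sets: "sets \<nu> = sets borel"
    and \<theta>: "0 < \<theta>" "integrable \<nu> (\<lambda>x. (\<phi> j \<bullet> x)\<^sup>2)" "(\<integral>x. (\<phi> j \<bullet> x)\<^sup>2 \<partial>\<nu>) = \<theta>"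
    and K: "1 \<le> K" "integrable \<nu> (\<lambda>x. (\<phi> j \<bullet> x) ^ 4)" "(\<integral>x. (\<phi> j \<bullet> x) ^ 4 \<partial>\<nu>) \<le> K * \<theta>\<^sup>2"
    and \<gamma>: "0 < \<gamma>" and j: "1 \<le> j" and N: "1 \<le> N"
    and a: "a = real N * (1 / \<gamma>\<^sup>2) * (\<sigma> j)\<^sup>2"
  shows "ennreal ((l j)\<^sup>2 / (1 + a * \<theta>)\<^sup>2 +
      (a * \<gamma>)\<^sup>2 / real N * (\<theta> / (2 * (1 + 2 * K)\<^sup>2 * (1 + a * \<theta>)\<^sup>2)))
    \<le> (\<integral>\<^sup>+D. ennreal ((l j - post_mean \<phi> \<sigma> \<gamma> N D j)\<^sup>2) \<partial>data_law \<phi> \<nu> l \<gamma> N)"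
    (is "ennreal ?bound \<le> _")
proof -
  interpret \<nu>: prob_space \<nu> by (rule prob)
  interpret X: prob_space "design_law \<nu> N"
    unfolding design_law_def by (rule prob_space_PiM[OF prob])
  interpret \<xi>: prob_space "noise_law N"
    unfolding noise_law_def by (rule prob_space_PiM[OF prob_space_gaussian]) simp
  define m where "m = 1 + a * \<theta>"
  define q where "q = m\<^sup>2 * (1 + 2 * K)\<^sup>2"
  define h where "h x = (l j)\<^sup>2 * (3 / m\<^sup>2 - 2 * (1 + a * (\<phi> j \<bullet> x)\<^sup>2) / m ^ 3) +
       (a * \<gamma>)\<^sup>2 / real N * (((\<phi> j \<bullet> x)\<^sup>2 - (\<phi> j \<bullet> x) ^ 4 / (2 * K * \<theta>)) / q)" for x
  have a0: "0 \<le> a" unfolding a by simp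
  have m: "0 < m" unfolding m_def using a0 \<theta>(1) by (intro add_pos_nonneg) auto
  have q: "0 < q" unfolding q_def using m K(1) by simp
  have h: "integrable \<nu> h" unfolding h_def[abs_def] using \<theta> K by simp
  have Eh: "?bound \<le> (\<integral>x. h x \<partial>\<nu>)"
  proof -
    have "(\<integral>x. h x \<partial>\<nu>) = (l j)\<^sup>2 * (3 / m\<^sup>2 - 2 * (1 + a * \<theta>) / m ^ 3) +
       (a * \<gamma>)\<^sup>2 / real N * ((\<theta> - (\<integral>x. (\<phi> j \<bullet> x) ^ 4 \<partial>\<nu>) / (2 * K * \<theta>)) / q)"
      unfolding h_def using \<theta> K by (simp add: \<nu>.prob_space)
    moreover have "3 / m\<^sup>2 - 2 * (1 + a * \<theta>) / m ^ 3 = 1 / m\<^sup>2"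
      using m unfolding m_def[symmetric] by (simp add: field_simps power2_eq_square power3_eq_cube)
    moreover have "(a * \<gamma>)\<^sup>2 / real N * (\<theta> / 2 / q) \<le>
        (a * \<gamma>)\<^sup>2 / real N * ((\<theta> - (\<integral>x. (\<phi> j \<bullet> x) ^ 4 \<partial>\<nu>) / (2 * K * \<theta>)) / q)"
    proof (intro mult_left_mono divide_right_mono)
      have "(\<integral>x. (\<phi> j \<bullet> x) ^ 4 \<partial>\<nu>) / (2 * K * \<theta>) \<le> K * \<theta>\<^sup>2 / (2 * K * \<theta>)"
        using K \<theta>(1) by (intro divide_right_mono) auto
      also have "\<dots> = \<theta> / 2"
        using K(1) \<theta>(1) by (simp add: power2_eq_square)
      finally show "\<theta> / 2 \<le> \<theta> - (\<integral>x. (\<phi> j \<bullet> x) ^ 4 \<partial>\<nu>) / (2 * K * \<theta>)" by simp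
    qed (use q in auto)
    moreover have "?bound = (l j)\<^sup>2 * (1 / m\<^sup>2) + (a * \<gamma>)\<^sup>2 / real N * (\<theta> / 2 / q)"
      by (simp add: m_def q_def mult_ac)
    ultimately show ?thesis
      by simp
  qed
  have hX: "integrable (design_law \<nu> N) (\<lambda>X. h (X n))" "(\<integral>X. h (X n) \<partial>design_law \<nu> N) = (\<integral>x. h x \<partial>\<nu>)"
    if "n \<in> {1..N}" for n
    using integral_PiM_component[of "{1..N}" "\<lambda>_. \<nu>" n h] prob that h by (auto simp: design_law_def)
  have "?bound \<le> (\<integral>X. 1 / real N * (\<Sum>n=1..N. h (X n)) \<partial>design_law \<nu> N)"
    using Eh N by (subst Bochner_Integration.integral_mult_right_zero, subst Bochner_Integration.integral_sum)
      (auto simp: hX)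
  then have "ennreal ?bound \<le> ennreal (\<integral>X. 1 / real N * (\<Sum>n=1..N. h (X n)) \<partial>design_law \<nu> N)"
    by (rule ennreal_leI)
  also have "\<dots> \<le> (\<integral>\<^sup>+X. ennreal (1 / real N * (\<Sum>n=1..N. h (X n))) \<partial>design_law \<nu> N)"
    by (intro ennreal_integral_le_nn_integral integrable_mult_right Bochner_Integration.integrable_sum hX)
  also have "\<dots> \<le> (\<integral>\<^sup>+X. (\<integral>\<^sup>+\<xi>. ennreal ((l j - post_mean \<phi> \<sigma> \<gamma> N (observe \<phi> l \<gamma> N (X, \<xi>)) j)\<^sup>2)
      \<partial>noise_law N) \<partial>design_law \<nu> N)"
  proof (rule nn_integral_mono)
    fix X :: "nat \<Rightarrow> 'h"
    define g where "g n = \<phi> j \<bullet> X n" for n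
    define G where "G = 1 / real N * (\<Sum>n=1..N. (g n)\<^sup>2)"
    define c where "c n = a * \<gamma> * g n / (real N * (1 + a * G))" for n
    have err: "l j - post_mean \<phi> \<sigma> \<gamma> N (observe \<phi> l \<gamma> N (X, \<xi>)) j =
        l j / (1 + a * G) - (\<Sum>n=1..N. c n * \<xi> (j, n))" for \<xi>
    proof -
      have "post_mean \<phi> \<sigma> \<gamma> N (observe \<phi> l \<gamma> N (X, \<xi>)) j =
          (a * (1 / real N * (\<Sum>n=1..N. (g n * l j + \<gamma> * \<xi> (j, n)) * g n))) / (1 + a * G)"
        using j by (simp add: post_mean_def observe_def a g_def G_def)
      then show ?thesis
        using posterior_mean_error_eq[OF N \<gamma> G_def a zero_le_power2] by (simp add: c_def)
    qed
    have "1 / real N * (\<Sum>n=1..N. h (X n)) \<le> (l j / (1 + a * G))\<^sup>2 + (\<Sum>n=1..N. (c n)\<^sup>2)"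
      using mean_error_integrand_ge[OF N a0 \<theta>(1), of "2 * K" G g "l j" \<gamma>] K(1) G_def
      by (simp add: h_def m_def q_def c_def g_def)
    then show "ennreal (1 / real N * (\<Sum>n=1..N. h (X n))) \<le>
        (\<integral>\<^sup>+\<xi>. ennreal ((l j - post_mean \<phi> \<sigma> \<gamma> N (observe \<phi> l \<gamma> N (X, \<xi>)) j)\<^sup>2) \<partial>noise_law N)"
      unfolding err nn_integral_noise_sq[OF j N] by (rule ennreal_leI)
  qed
  also have "\<dots> = (\<integral>\<^sup>+D. ennreal ((l j - post_mean \<phi> \<sigma> \<gamma> N D j)\<^sup>2) \<partial>data_law \<phi> \<nu> l \<gamma> N)"
  proof -
    have meas: "(\<lambda>D. ennreal ((l j - post_mean \<phi> \<sigma> \<gamma> N D j)\<^sup>2)) \<in> borel_measurable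
        (design_law \<nu> N \<Otimes>\<^sub>M (\<Pi>\<^sub>M jn\<in>{1..} \<times> {1..N}. borel))"
      using measurable_post_mean[OF sets j] by simp
    have "(\<integral>\<^sup>+D. ennreal ((l j - post_mean \<phi> \<sigma> \<gamma> N D j)\<^sup>2) \<partial>data_law \<phi> \<nu> l \<gamma> N) =
        (\<integral>\<^sup>+z. ennreal ((l j - post_mean \<phi> \<sigma> \<gamma> N (observe \<phi> l \<gamma> N z) j)\<^sup>2)
          \<partial>(design_law \<nu> N \<Otimes>\<^sub>M noise_law N))"
      unfolding data_law_def using meas
      by (intro nn_integral_distr[OF measurable_observe[OF sets]]) simp
    then show ?thesis
      using \<xi>.nn_integral_fst[OF measurable_compose[OF measurable_observe[OF sets] meas]] by simp
  qed
  finally show ?thesis .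
qed

section \<open>Reduction of the test errors to coordinate errors\<close>

lemma sum_coordinate_errors_eq:
  fixes \<phi> :: "nat \<Rightarrow> 'h::{real_inner, banach, second_countable_topology}"
  assumes sets: "sets \<nu> = sets borel" and F: "F \<subseteq> {1..}"
  shows "(\<Sum>j\<in>F. ennreal (q j) *
      (\<integral>\<^sup>+D. ennreal ((l j - post_mean \<phi> \<sigma> \<gamma> N D j)\<^sup>2) \<partial>data_law \<phi> \<nu> l \<gamma> N)) =
    (\<integral>\<^sup>+D. (\<Sum>j\<in>F. ennreal (q j) * ennreal ((l j - post_mean \<phi> \<sigma> \<gamma> N D j)\<^sup>2))
      \<partial>data_law \<phi> \<nu> l \<gamma> N)"
proof -
  have meas: "(\<lambda>D. ennreal ((l j - post_mean \<phi> \<sigma> \<gamma> N D j)\<^sup>2)) \<in> borel_measurable (data_law \<phi> \<nu> l \<gamma> N)"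
    if "j \<in> F" for j
    unfolding measurable_cong_sets[OF sets_data_law refl]
    using measurable_post_mean[OF sets, of j] that F by auto
  then show ?thesis
    by (subst nn_integral_sum) (auto simp: nn_integral_cmult)
qed

lemma mean_test_error_ge_sum:
  fixes \<phi> :: "nat \<Rightarrow> 'h::{real_inner, banach, second_countable_topology}"
    and b :: "'h \<Rightarrow> 'e::topological_space \<Rightarrow> real"
  assumes basis: "orthonormal_basis \<phi>" and sets: "sets \<nu> = sets borel"
    and cov: "covariance_wrt b \<nu>' \<Lambda>'" and F: "finite F" "F \<subseteq> {1..}"
  shows "(\<Sum>j\<in>F. ennreal (\<phi> j \<bullet> \<Lambda>' (\<phi> j)) *
      (\<integral>\<^sup>+D. ennreal ((l j - post_mean \<phi> \<sigma> \<gamma> N D j)\<^sup>2) \<partial>data_law \<phi> \<nu> l \<gamma> N))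
    \<le> mean_test_error \<phi> \<nu> l \<gamma> \<sigma> b \<nu>' N"
proof -
  have "(\<Sum>j\<in>F. ennreal (\<phi> j \<bullet> \<Lambda>' (\<phi> j)) *
      (\<integral>\<^sup>+D. ennreal ((l j - post_mean \<phi> \<sigma> \<gamma> N D j)\<^sup>2) \<partial>data_law \<phi> \<nu> l \<gamma> N)) =
    (\<integral>\<^sup>+D. (\<Sum>j\<in>F. ennreal (\<phi> j \<bullet> \<Lambda>' (\<phi> j)) * ennreal ((l j - post_mean \<phi> \<sigma> \<gamma> N D j)\<^sup>2))
      \<partial>data_law \<phi> \<nu> l \<gamma> N)"
    by (rule sum_coordinate_errors_eq[OF sets F(2)])
  also have "\<dots> \<le> mean_test_error \<phi> \<nu> l \<gamma> \<sigma> b \<nu>' N"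
    unfolding mean_test_error_def
    by (intro nn_integral_mono L2_norm_sq_ge_sum[OF basis cov F])
  finally show ?thesis .
qed

text \<open>Given the data, each eigenvalue has a Gaussian law centred at the posterior mean, so by Jensen's inequality the
expected squared error of a draw is at least that of the mean.\<close>

lemma full_test_error_ge_sum:
  fixes \<phi> :: "nat \<Rightarrow> 'h::{real_inner, banach, second_countable_topology}"
    and b :: "'h \<Rightarrow> 'e::topological_space \<Rightarrow> real"
  assumes basis: "orthonormal_basis \<phi>" and sets: "sets \<nu> = sets borel"
    and prior: "\<forall>j\<ge>1. 0 < (\<sigma> j)\<^sup>2"
    and cov: "covariance_wrt b \<nu>' \<Lambda>'" and F: "finite F" "F \<subseteq> {1..}"
  shows "(\<Sum>j\<in>F. ennreal (\<phi> j \<bullet> \<Lambda>' (\<phi> j)) *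
      (\<integral>\<^sup>+D. ennreal ((l j - post_mean \<phi> \<sigma> \<gamma> N D j)\<^sup>2) \<partial>data_law \<phi> \<nu> l \<gamma> N))
    \<le> full_test_error \<phi> \<nu> l \<gamma> \<sigma> b \<nu>' N"
proof -
  have pv: "0 < post_var \<phi> \<sigma> \<gamma> N D j" if "j \<in> {1..}" for D j
    using prior that
    by (auto simp: post_var_def split: prod.split
        intro!: divide_pos_pos add_pos_nonneg mult_nonneg_nonneg sum_nonneg divide_nonneg_nonneg)
  have inner: "(\<Sum>j\<in>F. ennreal (\<phi> j \<bullet> \<Lambda>' (\<phi> j)) * ennreal ((l j - post_mean \<phi> \<sigma> \<gamma> N D j)\<^sup>2)) \<le>
      (\<integral>\<^sup>+lN. L2_norm_sq b \<phi> \<nu>' (\<lambda>j. l j - lN j) \<partial>posterior \<phi> \<sigma> \<gamma> N D)" for D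
  proof -
    let ?G = "\<lambda>j. gaussian (post_mean \<phi> \<sigma> \<gamma> N D j) (post_var \<phi> \<sigma> \<gamma> N D j)"
    have coord: "(\<lambda>lN. ennreal ((l j - lN j)\<^sup>2)) \<in> borel_measurable (posterior \<phi> \<sigma> \<gamma> N D)" if "j \<in> F" for j
    proof -
      have "(\<lambda>lN. lN j) \<in> measurable (PiM {1..} ?G) (?G j)"
        using that F by (intro measurable_component_singleton) auto
      then have "(\<lambda>lN. lN j) \<in> borel_measurable (posterior \<phi> \<sigma> \<gamma> N D)"
        by (simp add: posterior_def cong: measurable_cong_sets)
      then show ?thesis by simp
    qed
    have "(\<Sum>j\<in>F. ennreal (\<phi> j \<bullet> \<Lambda>' (\<phi> j)) * ennreal ((l j - post_mean \<phi> \<sigma> \<gamma> N D j)\<^sup>2)) \<le>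
        (\<Sum>j\<in>F. ennreal (\<phi> j \<bullet> \<Lambda>' (\<phi> j)) * (\<integral>\<^sup>+lN. ennreal ((l j - lN j)\<^sup>2) \<partial>posterior \<phi> \<sigma> \<gamma> N D))"
    proof (intro sum_mono mult_left_mono)
      fix j assume "j \<in> F"
      then have j: "j \<in> {1..}" using F by auto
      have "(\<integral>\<^sup>+lN. ennreal ((l j - lN j)\<^sup>2) \<partial>posterior \<phi> \<sigma> \<gamma> N D) = (\<integral>\<^sup>+x. ennreal ((l j - x)\<^sup>2) \<partial>?G j)"
        unfolding posterior_def
        by (rule nn_integral_PiM_component[of "{1..}" ?G j "\<lambda>x. ennreal ((l j - x)\<^sup>2)"])
          (use j in \<open>auto intro!: prob_space_gaussian pv\<close>)
      then show "ennreal ((l j - post_mean \<phi> \<sigma> \<gamma> N D j)\<^sup>2) \<le>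
          (\<integral>\<^sup>+lN. ennreal ((l j - lN j)\<^sup>2) \<partial>posterior \<phi> \<sigma> \<gamma> N D)"
        using nn_integral_sq_gaussian_ge[OF pv[OF j]] by simp
    qed simp
    also have "\<dots> = (\<integral>\<^sup>+lN. (\<Sum>j\<in>F. ennreal (\<phi> j \<bullet> \<Lambda>' (\<phi> j)) * ennreal ((l j - lN j)\<^sup>2))
        \<partial>posterior \<phi> \<sigma> \<gamma> N D)"
      using coord by (subst nn_integral_sum) (auto simp: nn_integral_cmult)
    also have "\<dots> \<le> (\<integral>\<^sup>+lN. L2_norm_sq b \<phi> \<nu>' (\<lambda>j. l j - lN j) \<partial>posterior \<phi> \<sigma> \<gamma> N D)"
      by (intro nn_integral_mono L2_norm_sq_ge_sum[OF basis cov F])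
    finally show ?thesis .
  qed
  have "(\<Sum>j\<in>F. ennreal (\<phi> j \<bullet> \<Lambda>' (\<phi> j)) *
      (\<integral>\<^sup>+D. ennreal ((l j - post_mean \<phi> \<sigma> \<gamma> N D j)\<^sup>2) \<partial>data_law \<phi> \<nu> l \<gamma> N)) =
    (\<integral>\<^sup>+D. (\<Sum>j\<in>F. ennreal (\<phi> j \<bullet> \<Lambda>' (\<phi> j)) * ennreal ((l j - post_mean \<phi> \<sigma> \<gamma> N D j)\<^sup>2))
      \<partial>data_law \<phi> \<nu> l \<gamma> N)"
    by (rule sum_coordinate_errors_eq[OF sets F(2)])
  also have "\<dots> \<le> full_test_error \<phi> \<nu> l \<gamma> \<sigma> b \<nu>' N"
    unfolding full_test_error_def by (intro nn_integral_mono inner)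
  finally show ?thesis .
qed

section \<open>The cut-off index and the rate\<close>

text \<open>Only the upper half of the range is used: there \<open>j\<close> lies between \<open>J/2\<close> and \<open>J\<close>, so every term is comparable to
\<open>J\<close> to the power \<open>r\<close>, whatever the sign of \<open>r\<close>.\<close>

lemma powr_sum_upper_half_ge:
  fixes r :: real and J j0 :: nat
  assumes j0: "1 \<le> j0" and J: "2 * j0 \<le> J"
  shows "min 1 (2 powr - r) / 2 * real J powr (1 + r) \<le> (\<Sum>j=j0..J. real j powr r)"
proof -
  let ?m = "min 1 (2 powr - r)"
  have Jpos: "0 < real J" using assms by simp
  have term_ge: "?m * real J powr r \<le> real j powr r" if "j \<in> {J - J div 2..J}" for j
  proof -
    have j: "real J / 2 \<le> real j" "real j \<le> real J" using that by auto
    show ?thesis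
    proof (cases "0 \<le> r")
      case True
      have "?m * real J powr r \<le> 2 powr - r * real J powr r"
        by (intro mult_right_mono) auto
      also have "\<dots> = (real J / 2) powr r"
        by (simp add: powr_divide powr_minus_divide)
      also have "\<dots> \<le> real j powr r"
        using j True by (intro powr_mono2) auto
      finally show ?thesis .
    next
      case False
      have "?m * real J powr r \<le> 1 * real J powr r"
        by (intro mult_right_mono) auto
      also have "\<dots> \<le> real j powr r"
        using j False Jpos by (simp add: powr_mono2')
      finally show ?thesis .
    qed
  qed
  have "?m / 2 * real J powr (1 + r) = (real J / 2) * (?m * real J powr r)"
    using Jpos by (simp add: powr_add)
  also have "\<dots> \<le> real (card {J - J div 2..J}) * (?m * real J powr r)"
    by (intro mult_right_mono) auto
  also have "\<dots> \<le> (\<Sum>j\<in>{J - J div 2..J}. real j powr r)"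
    using term_ge by (rule sum_bounded_below)
  also have "\<dots> \<le> (\<Sum>j=j0..J. real j powr r)"
    using J by (intro sum_mono2) auto
  finally show ?thesis .
qed

lemma harmonic_sum_ge_ln:
  assumes j0: "1 \<le> j0" and J: "j0 \<le> J"
  shows "ln (real J + 1) - ln (real j0) \<le> (\<Sum>j=j0..J. real j powr (-1))"
  using J
proof (induction J rule: dec_induct)
  case base
  have "ln (real j0 + 1) - ln (real j0) = ln (1 + 1 / real j0)"
    using j0 ln_divide_pos[of "real j0 + 1" "real j0"] by (simp add: add_divide_distrib)
  also have "\<dots> \<le> 1 / real j0" by (rule ln_add_one_self_le_self) simp
  finally show ?case using j0 by (simp add: powr_minus_divide)
next
  case (step J)
  have "ln (real J + 2) - ln (real J + 1) = ln (1 + 1 / (real J + 1))"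
    using ln_divide_pos[of "real J + 2" "real J + 1"]
    by (simp add: add_divide_distrib[symmetric] add_ac divide_add_eq_iff add_divide_eq_iff)
  also have "\<dots> \<le> 1 / (real J + 1)" by (rule ln_add_one_self_le_self) simp
  finally show ?case using step by (simp add: powr_minus_divide add_ac)
qed

lemma J_cut_bounds:
  assumes "0 < \<alpha> + p"
  shows "real (J_cut \<alpha> p N) \<le> real N powr (1 / (2 * (\<alpha> + p)))"
    "real N powr (1 / (2 * (\<alpha> + p))) < real (J_cut \<alpha> p N) + 1"
proof -
  have "0 \<le> \<lfloor>real N powr (1 / (2 * (\<alpha> + p)))\<rfloor>" by simp
  then have "real (J_cut \<alpha> p N) = of_int \<lfloor>real N powr (1 / (2 * (\<alpha> + p)))\<rfloor>"
    by (simp add: J_cut_def)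
  then show "real (J_cut \<alpha> p N) \<le> real N powr (1 / (2 * (\<alpha> + p)))"
    "real N powr (1 / (2 * (\<alpha> + p))) < real (J_cut \<alpha> p N) + 1"
    by linarith+
qed

lemma filterlim_J_cut:
  assumes "0 < \<alpha> + p"
  shows "filterlim (J_cut \<alpha> p) at_top sequentially"
proof -
  have "filterlim (\<lambda>N. real N powr (1 / (2 * (\<alpha> + p)))) at_top sequentially"
  proof (rule filterlim_mono_eventually)
    show "filterlim (\<lambda>N. exp (1 / (2 * (\<alpha> + p)) * ln (real N))) at_top sequentially"
      using assms
      by (intro filterlim_compose[OF exp_at_top] filterlim_tendsto_pos_mult_at_top[OF tendsto_const]
          filterlim_compose[OF ln_at_top filterlim_real_sequentially]) auto
    show "\<forall>\<^sub>F N in sequentially. exp (1 / (2 * (\<alpha> + p)) * ln (real N)) = real N powr (1 / (2 * (\<alpha> + p)))"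
      using eventually_gt_at_top[of 0] by eventually_elim (simp add: powr_def)
  qed auto
  then have "filterlim (\<lambda>N. \<lfloor>real N powr (1 / (2 * (\<alpha> + p)))\<rfloor>) at_top sequentially"
    by (rule filterlim_compose[OF filterlim_floor_sequentially])
  then show ?thesis
    unfolding J_cut_def[abs_def] by (rule filterlim_compose[OF filterlim_nat_sequentially])
qed

text \<open>The cut separates the coordinates that the data determine from those left to the prior.\<close>

lemma le_J_cut_iff:
  assumes "0 < \<alpha> + p" "1 \<le> j" "1 \<le> N"
  shows "j \<le> J_cut \<alpha> p N \<longleftrightarrow> 1 \<le> real N * real j powr (-2 * (\<alpha> + p))"
proof -
  let ?e = "1 / (2 * (\<alpha> + p))"
  have e: "0 < ?e" using assms by simp
  have "j \<le> J_cut \<alpha> p N \<longleftrightarrow> real j \<le> real N powr ?e"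
    using J_cut_bounds[OF assms(1), of N] by linarith
  also have "\<dots> \<longleftrightarrow> real j powr (2 * (\<alpha> + p)) \<le> (real N powr ?e) powr (2 * (\<alpha> + p))"
    using assms powr_mono2[of "2 * (\<alpha> + p)" "real j" "real N powr ?e"]
      powr_less_mono2[of "2 * (\<alpha> + p)" "real N powr ?e" "real j"]
    by (meson leD leI mult_pos_pos of_nat_0_le_iff order_less_imp_le powr_ge_zero zero_less_numeral)
  also have "(real N powr ?e) powr (2 * (\<alpha> + p)) = real N"
    using assms by (simp add: powr_powr)
  also have "real j powr (2 * (\<alpha> + p)) \<le> real N \<longleftrightarrow> 1 \<le> real N * real j powr (-2 * (\<alpha> + p))"
  proof -
    have "real N * real j powr (-2 * (\<alpha> + p)) = real N / real j powr (2 * (\<alpha> + p))"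
      using powr_minus_divide[of "real j" "2 * (\<alpha> + p)"] by simp
    then show ?thesis
      using assms by (simp add: le_divide_eq)
  qed
  finally show ?thesis .
qed

text \<open>The three cases of the rate are the three growth regimes of a partial sum of powers. In the last regime a single
term is enough.\<close>

lemma rate_le_head_sum:
  assumes pos: "0 < \<alpha> + p" and j0: "1 \<le> j0"
  shows "\<exists>c>0. \<forall>\<^sub>F N in sequentially. c * rate \<alpha> \<alpha>' p N \<le>
    (\<Sum>j=j0..J_cut \<alpha> p N. real j powr (2 * (\<alpha> - \<alpha>')) / real N)"
proof -
  define J where "J = J_cut \<alpha> p"
  define x where "x N = real N powr (1 / (2 * (\<alpha> + p)))" for N :: nat
  define r where "r = 2 * (\<alpha> - \<alpha>')"
  have J: "real (J N) \<le> x N" "x N < real (J N) + 1" for N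
    using J_cut_bounds[OF pos, of N] by (auto simp: J_def x_def)
  have J_large: "\<forall>\<^sub>F N in sequentially. k \<le> J N" for k
    using filterlim_J_cut[OF pos] by (simp add: J_def filterlim_at_top)
  have sum_eq: "(\<Sum>j=j0..J N. real j powr r / real N) = (\<Sum>j=j0..J N. real j powr r) / real N" for N
    by (simp add: sum_divide_distrib)
  have "\<exists>c>0. \<forall>\<^sub>F N in sequentially. c * rate \<alpha> \<alpha>' p N \<le> (\<Sum>j=j0..J N. real j powr r) / real N"
  proof -
    consider "\<alpha>' < \<alpha> + 1/2" | "\<alpha>' = \<alpha> + 1/2" | "\<alpha>' > \<alpha> + 1/2" by linarith
    then show ?thesis
    proof cases
      case 1
      then have r: "0 < 1 + r" by (simp add: r_def)
      define c where "c = min 1 (2 powr - r) / 2 * (1/2) powr (1 + r)"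
      have "0 < c" unfolding c_def by (intro mult_pos_pos) (auto simp: min_def)
      moreover have "\<forall>\<^sub>F N in sequentially. c * rate \<alpha> \<alpha>' p N \<le> (\<Sum>j=j0..J N. real j powr r) / real N"
        using J_large[of "2 * j0"] eventually_ge_at_top[of 1]
      proof eventually_elim
        case (elim N)
        have "x N / 2 \<le> real (J N)"
          using J[of N] elim j0 by linarith
        have "rate \<alpha> \<alpha>' p N = x N powr (1 + r) / real N"
        proof -
          have "x N powr (1 + r) = real N powr ((\<alpha> + 1/2 - \<alpha>') / (\<alpha> + p))"
            using pos by (simp add: x_def r_def powr_powr field_simps)
          then show ?thesis
            using 1 elim by (simp add: rate_def powr_diff powr_minus_divide)
        qed
        then have "c * rate \<alpha> \<alpha>' p N = min 1 (2 powr - r) / 2 * (x N / 2) powr (1 + r) / real N"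
          by (simp add: c_def powr_divide x_def)
        also have "\<dots> \<le> min 1 (2 powr - r) / 2 * real (J N) powr (1 + r) / real N"
          using \<open>x N / 2 \<le> real (J N)\<close> r
          by (intro divide_right_mono mult_left_mono powr_mono2) (auto simp: x_def)
        also have "\<dots> \<le> (\<Sum>j=j0..J N. real j powr r) / real N"
          using powr_sum_upper_half_ge[OF j0] elim by (intro divide_right_mono) auto
        finally show ?case .
      qed
      ultimately show ?thesis by blast
    next
      case 2
      then have r: "r = -1" by (simp add: r_def)
      define c where "c = 1 / (4 * (\<alpha> + p))"
      have "0 < c" using pos by (simp add: c_def)
      have "filterlim (\<lambda>N. ln (real N)) at_top sequentially"
        by (rule filterlim_compose[OF ln_at_top filterlim_real_sequentially])
      then have ln_large: "\<forall>\<^sub>F N in sequentially. ln (real j0) / c \<le> ln (real N)"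
        by (simp add: filterlim_at_top)
      have "\<forall>\<^sub>F N in sequentially. c * rate \<alpha> \<alpha>' p N \<le> (\<Sum>j=j0..J N. real j powr r) / real N"
        using J_large[of j0] ln_large eventually_ge_at_top[of 1]
      proof eventually_elim
        case (elim N)
        have "c * ln (real N) + ln (real j0) \<le> 2 * c * ln (real N)"
          using elim(2) \<open>0 < c\<close> by (simp add: field_simps)
        also have "\<dots> = ln (x N)"
          using elim pos by (simp add: c_def x_def ln_powr field_simps)
        also have "\<dots> \<le> ln (real (J N) + 1)"
          using J(2)[of N] elim by (intro ln_mono) (auto simp: x_def)
        finally have "c * ln (real N) \<le> ln (real (J N) + 1) - ln (real j0)" by simp
        also have "\<dots> \<le> (\<Sum>j=j0..J N. real j powr r)"
          unfolding r by (rule harmonic_sum_ge_ln[OF j0 elim(1)])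
        finally have "c * ln (real N) / real N \<le> (\<Sum>j=j0..J N. real j powr r) / real N"
          by (intro divide_right_mono) auto
        then show ?case
          using 2 elim by (simp add: rate_def powr_minus_divide)
      qed
      with \<open>0 < c\<close> show ?thesis by blast
    next
      case 3
      have "\<forall>\<^sub>F N in sequentially. real j0 powr r * rate \<alpha> \<alpha>' p N \<le> (\<Sum>j=j0..J N. real j powr r) / real N"
        using J_large[of j0] eventually_ge_at_top[of 1]
      proof eventually_elim
        case (elim N)
        have "real j0 powr r \<le> (\<Sum>j=j0..J N. real j powr r)"
          using elim by (intro member_le_sum) auto
        then have "real j0 powr r / real N \<le> (\<Sum>j=j0..J N. real j powr r) / real N"
          by (rule divide_right_mono) simp
        then show ?case
          using 3 elim by (simp add: rate_def powr_minus_divide)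
      qed
      moreover have "0 < real j0 powr r" using j0 by simp
      ultimately show ?thesis by blast
    qed
  qed
  then show ?thesis
    unfolding J_def[symmetric] r_def[symmetric] sum_eq .
qed

lemma tail_sum_le:
  assumes "\<And>F. finite F \<Longrightarrow> F \<subseteq> {J<..} \<Longrightarrow>
    (\<Sum>j\<in>F. ennreal (real j powr (-2 * \<alpha>') * \<bar>l j\<bar>\<^sup>2)) \<le> B"
  shows "tail_sum \<alpha>' l J \<le> B"
  unfolding tail_sum_def
  by (rule infsum_le_finite_sums[OF nonneg_summable_on_complete assms]) auto

text \<open>The conventions for division cause no trouble: where \<open>e N = 0\<close>, also \<open>f N = 0\<close>, and the quotient is \<open>0\<close>.\<close>

lemma ennreal_bigomegaI:
  assumes "\<forall>\<^sub>F N in sequentially. f N \<le> ennreal C * e N"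
  shows "ennreal_bigomega e f"
proof -
  have "f N / e N \<le> ennreal C" if "f N \<le> ennreal C * e N" for N
  proof (cases "e N = 0")
    case True
    then show ?thesis using that by simp
  next
    case False
    then show ?thesis
      using that by (intro divide_le_posI_ennreal) (auto simp: mult.commute zero_less_iff_neq_zero)
  qed
  with assms have "\<forall>\<^sub>F N in sequentially. f N / e N \<le> ennreal C"
    by (auto elim: eventually_mono)
  then have "limsup (\<lambda>N. f N / e N) \<le> ennreal C"
    by (rule Limsup_bounded)
  also have "ennreal C < \<top>" by simp
  finally show ?thesis
    by (simp add: ennreal_bigomega_def ennreal_bigo_def)
qed

text \<open>Bounds on single coordinates are needed only from some \<open>j0\<close> on, because the cut eventually reaches \<open>j0\<close>. For the tail, the
infinite sum is the supremum of its finite partial sums.\<close>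

lemma ennreal_bigomega_rate_tail:
  fixes e :: "nat \<Rightarrow> ennreal" and w :: "nat \<Rightarrow> nat \<Rightarrow> real"
  assumes pos: "0 < \<alpha> + p" and c: "0 < c" and j0: "1 \<le> j0"
    and e: "\<And>N F. 1 \<le> N \<Longrightarrow> finite F \<Longrightarrow> F \<subseteq> {1..} \<Longrightarrow> (\<Sum>j\<in>F. ennreal (w N j)) \<le> e N"
    and head: "\<And>N j. 1 \<le> N \<Longrightarrow> j0 \<le> j \<Longrightarrow> j \<le> J_cut \<alpha> p N \<Longrightarrow>
      c * (real j powr (2 * (\<alpha> - \<alpha>')) / real N) \<le> w N j"
    and tail: "\<And>N j. 1 \<le> N \<Longrightarrow> j0 \<le> j \<Longrightarrow> J_cut \<alpha> p N < j \<Longrightarrow>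
      c * (real j powr (-2 * \<alpha>') * \<bar>l j\<bar>\<^sup>2) \<le> w N j"
    and t: "\<forall>\<^sub>F N in sequentially. t N \<le> 1"
  shows "ennreal_bigomega e
    (\<lambda>N. ennreal (t N * rate \<alpha> \<alpha>' p N) + tail_sum \<alpha>' l (J_cut \<alpha> p N))"
proof -
  obtain d where d: "0 < d" and rate: "\<forall>\<^sub>F N in sequentially. d * rate \<alpha> \<alpha>' p N \<le>
    (\<Sum>j=j0..J_cut \<alpha> p N. real j powr (2 * (\<alpha> - \<alpha>')) / real N)"
    using rate_le_head_sum[OF pos j0] by blast
  have large: "\<forall>\<^sub>F N in sequentially. j0 \<le> J_cut \<alpha> p N"
    using filterlim_J_cut[OF pos] by (simp add: filterlim_at_top)
  have "\<forall>\<^sub>F N in sequentially. ennreal (t N * rate \<alpha> \<alpha>' p N) + tail_sum \<alpha>' l (J_cut \<alpha> p N) \<le>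
      ennreal (1 / (c * d) + 1 / c) * e N"
    using rate large t eventually_ge_at_top[of 1]
  proof eventually_elim
    case (elim N)
    let ?J = "J_cut \<alpha> p N"
    have rate0: "0 \<le> rate \<alpha> \<alpha>' p N"
      using elim by (auto simp: rate_def)
    have "ennreal (t N * rate \<alpha> \<alpha>' p N) \<le> ennreal (rate \<alpha> \<alpha>' p N)"
      using mult_right_mono[OF elim(3) rate0] by (intro ennreal_leI) simp
    also have "\<dots> \<le> ennreal (1 / (c * d)) * e N"
    proof -
      have "c * d * rate \<alpha> \<alpha>' p N \<le> c * (\<Sum>j=j0..?J. real j powr (2 * (\<alpha> - \<alpha>')) / real N)"
        using elim(1) c by (simp add: mult.assoc)
      also have "\<dots> \<le> (\<Sum>j=j0..?J. w N j)"
        unfolding sum_distrib_left using elim by (intro sum_mono head) auto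
      finally have "rate \<alpha> \<alpha>' p N \<le> 1 / (c * d) * (\<Sum>j=j0..?J. w N j)"
        using c d by (simp add: field_simps)
      then have "ennreal (rate \<alpha> \<alpha>' p N) \<le> ennreal (1 / (c * d)) * ennreal (\<Sum>j=j0..?J. w N j)"
        using c d by (subst ennreal_mult'[symmetric]) (auto intro: ennreal_leI)
      also have "ennreal (\<Sum>j=j0..?J. w N j) = (\<Sum>j=j0..?J. ennreal (w N j))"
      proof (rule sum_ennreal[symmetric])
        fix j assume "j \<in> {j0..?J}"
        then have "c * (real j powr (2 * (\<alpha> - \<alpha>')) / real N) \<le> w N j"
          using elim by (intro head) auto
        moreover have "0 \<le> c * (real j powr (2 * (\<alpha> - \<alpha>')) / real N)"
          using c by simp
        ultimately show "0 \<le> w N j" by linarith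
      qed
      also have "\<dots> \<le> e N"
        using j0 elim by (intro e) auto
      finally show ?thesis by (simp add: mult_left_mono)
    qed
    finally have 1: "ennreal (t N * rate \<alpha> \<alpha>' p N) \<le> ennreal (1 / (c * d)) * e N" .
    have 2: "tail_sum \<alpha>' l ?J \<le> ennreal (1 / c) * e N"
    proof (rule tail_sum_le)
      fix F assume F: "finite F" "F \<subseteq> {?J<..}"
      have "(\<Sum>j\<in>F. ennreal (real j powr (-2 * \<alpha>') * \<bar>l j\<bar>\<^sup>2)) \<le> (\<Sum>j\<in>F. ennreal (1 / c) * ennreal (w N j))"
      proof (rule sum_mono)
        fix j assume "j \<in> F"
        then have "c * (real j powr (-2 * \<alpha>') * \<bar>l j\<bar>\<^sup>2) \<le> w N j"
          using F elim by (intro tail) auto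
        then have "real j powr (-2 * \<alpha>') * \<bar>l j\<bar>\<^sup>2 \<le> 1 / c * w N j"
          using c by (simp add: field_simps)
        then show "ennreal (real j powr (-2 * \<alpha>') * \<bar>l j\<bar>\<^sup>2) \<le> ennreal (1 / c) * ennreal (w N j)"
          using c by (subst ennreal_mult'[symmetric]) (auto intro: ennreal_leI)
      qed
      also have "\<dots> = ennreal (1 / c) * (\<Sum>j\<in>F. ennreal (w N j))"
        by (simp add: sum_distrib_left)
      also have "\<dots> \<le> ennreal (1 / c) * e N"
        using F elim j0 by (intro mult_left_mono e) auto
      finally show "(\<Sum>j\<in>F. ennreal (real j powr (-2 * \<alpha>') * \<bar>l j\<bar>\<^sup>2)) \<le> ennreal (1 / c) * e N" .
    qed
    have "ennreal (1 / (c * d) + 1 / c) * e N = ennreal (1 / (c * d)) * e N + ennreal (1 / c) * e N"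
      using c d by (simp add: ennreal_plus distrib_right)
    with add_mono[OF 1 2] show ?case by simp
  qed
  then show ?thesis by (rule ennreal_bigomegaI)
qed

section \<open>The lower bounds for the test errors\<close>

lemma bigtheta_powr_bounds:
  fixes f :: "nat \<Rightarrow> real"
  assumes f: "f \<in> \<Theta>(\<lambda>j. real j powr q)" and nonneg: "\<And>j. 0 \<le> f j"
  obtains c C where "0 < c" "0 < C"
    "\<forall>\<^sub>F j in sequentially. c * real j powr q \<le> f j \<and> f j \<le> C * real j powr q"
proof -
  from f obtain C where C: "0 < C" "\<forall>\<^sub>F j in sequentially. norm (f j) \<le> C * norm (real j powr q)"
    using landau_o.bigE[OF bigthetaD1[OF f]] by blast
  from f obtain c where c: "0 < c" "\<forall>\<^sub>F j in sequentially. norm (f j) \<ge> c * norm (real j powr q)"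
    using landau_omega.bigE[OF bigthetaD2[OF f]] by blast
  from C(2) c(2) have "\<forall>\<^sub>F j in sequentially. c * real j powr q \<le> f j \<and> f j \<le> C * real j powr q"
    by eventually_elim (simp add: nonneg)
  with c(1) C(1) show thesis by (rule that)
qed

text \<open>Here \<open>x\<close> stands for the decay of the test variance \<open>V\<close>, \<open>t\<close> for the true eigenvalue and \<open>d\<close> for the variance
term; a bounded \<open>A = a \<theta>\<close> keeps the bias.\<close>

lemma coordinate_bound_tail:
  fixes A R V t v x d :: real
  assumes "0 \<le> A" "A \<le> R" "v * x \<le> V" "0 \<le> v" "0 \<le> x" "0 \<le> d"
  shows "v / (1 + R)\<^sup>2 * (x * t\<^sup>2) \<le> V * (t\<^sup>2 / (1 + A)\<^sup>2 + d)"
proof -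
  have "v / (1 + R)\<^sup>2 * (x * t\<^sup>2) = v * x * (t\<^sup>2 / (1 + R)\<^sup>2)" by simp
  also have "\<dots> \<le> V * (t\<^sup>2 / (1 + A)\<^sup>2)"
  proof (intro mult_mono divide_left_mono)
    show "(1 + A)\<^sup>2 \<le> (1 + R)\<^sup>2" using assms by (intro power_mono) auto
    have "0 < 1 + A" "0 < 1 + R" using assms by auto
    then show "0 < (1 + R)\<^sup>2 * (1 + A)\<^sup>2" by simp
    show "0 \<le> V" using assms by (meson mult_nonneg_nonneg order_trans)
  qed (use assms in auto)
  also have "\<dots> \<le> V * (t\<^sup>2 / (1 + A)\<^sup>2 + d)"
    using assms by (intro mult_left_mono) (auto intro: order_trans[OF mult_nonneg_nonneg])
  finally show ?thesis .
qed

text \<open>Here \<open>x\<close> and \<open>1/y\<close> stand for the decay of the test variance \<open>V\<close> and of the training variance \<open>\<theta>\<close>, and \<open>d\<close> for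
the bias term. With \<open>A = a \<theta>\<close> the variance term is a multiple of \<open>(A / (1 + A))\<^sup>2 / (n \<theta>)\<close>, and the first
factor is bounded below once \<open>A \<ge> r\<close>.\<close>

lemma coordinate_bound_head:
  fixes a \<theta> \<gamma> r T y v x V n \<kappa> d :: real
  assumes "0 \<le> a" "0 < \<theta>" "0 < r" "r \<le> a * \<theta>" "\<theta> \<le> T / y" "0 < y" "0 < T" "0 < n" "0 < \<kappa>"
    and "v * x \<le> V" "0 \<le> v" "0 \<le> x" "0 \<le> d"
  shows "v * \<gamma>\<^sup>2 * (r / (1 + r))\<^sup>2 / (2 * \<kappa> * T) * (x * y / n) \<le>
    V * (d + (a * \<gamma>)\<^sup>2 / n * (\<theta> / (2 * \<kappa> * (1 + a * \<theta>)\<^sup>2)))"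
proof -
  define A where "A = a * \<theta>"
  have A: "0 < 1 + A" "r \<le> A" using assms by (auto simp: A_def)
  have "r / (1 + r) \<le> A / (1 + A)"
    using A assms(3) by (simp add: field_simps)
  then have "(r / (1 + r))\<^sup>2 \<le> (A / (1 + A))\<^sup>2"
    using assms(3) by (intro power_mono) auto
  moreover have "y / T \<le> 1 / \<theta>"
    using assms by (simp add: field_simps)
  ultimately have "(r / (1 + r))\<^sup>2 * (y / T) \<le> (A / (1 + A))\<^sup>2 * (1 / \<theta>)"
    using assms by (intro mult_mono) auto
  then have "\<gamma>\<^sup>2 / (2 * \<kappa> * n) * ((r / (1 + r))\<^sup>2 * (y / T)) \<le> \<gamma>\<^sup>2 / (2 * \<kappa> * n) * ((A / (1 + A))\<^sup>2 * (1 / \<theta>))"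
    using assms by (intro mult_left_mono) auto
  also have "\<dots> = (a * \<gamma>)\<^sup>2 / n * (\<theta> / (2 * \<kappa> * (1 + a * \<theta>)\<^sup>2))"
    using assms A(1) unfolding A_def
    by (simp add: power_divide power_mult_distrib) (simp add: power2_eq_square mult_ac)
  finally have *: "\<gamma>\<^sup>2 / (2 * \<kappa> * n) * ((r / (1 + r))\<^sup>2 * (y / T)) \<le>
      d + (a * \<gamma>)\<^sup>2 / n * (\<theta> / (2 * \<kappa> * (1 + a * \<theta>)\<^sup>2))"
    using assms by simp
  have "v * \<gamma>\<^sup>2 * (r / (1 + r))\<^sup>2 / (2 * \<kappa> * T) * (x * y / n) =
      v * x * (\<gamma>\<^sup>2 / (2 * \<kappa> * n) * ((r / (1 + r))\<^sup>2 * (y / T)))"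
    by (simp add: mult_ac)
  also have "\<dots> \<le> V * (d + (a * \<gamma>)\<^sup>2 / n * (\<theta> / (2 * \<kappa> * (1 + a * \<theta>)\<^sup>2)))"
    using assms by (intro mult_mono *) (auto intro: order_trans[OF mult_nonneg_nonneg])
  finally show ?thesis .
qed

theorem theorem3p4:
  fixes \<phi> :: "nat \<Rightarrow> 'h::{real_inner, banach, second_countable_topology}"
    and \<nu> :: "'h measure" and \<Lambda> :: "'h \<Rightarrow> 'h"
    and b :: "'h \<Rightarrow> 'e::topological_space \<Rightarrow> real"
    and \<nu>' :: "'e measure" and \<Lambda>' :: "'h \<Rightarrow> 'h"
    and l \<sigma> :: "nat \<Rightarrow> real"
    and \<gamma> s p \<alpha> \<alpha>' :: real
  assumes basis: "orthonormal_basis \<phi>"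
    and gamma: "\<gamma> > 0"
    and training: "training_distribution \<phi> \<nu> \<Lambda>"
    and test: "test_distribution b \<nu>' \<Lambda>'"
    and prior: "\<forall>j\<ge>1. (\<sigma> j)\<^sup>2 > 0"
    and alpha: "\<alpha> > 1/2" and alpha': "\<alpha>' \<ge> 0"
    and min_s: "min \<alpha> \<alpha>' + s > 0"
    and min_p: "min \<alpha> \<alpha>' + (p - 1/2) > 0"
    and truth: "l \<in> Hs s"
    and prior_decay: "(\<lambda>j. (\<sigma> j)\<^sup>2) \<in> \<Theta>(\<lambda>j. real j powr (-2 * p))"
    and training_decay: "(\<lambda>j. \<phi> j \<bullet> \<Lambda> (\<phi> j)) \<in> \<Theta>(\<lambda>j. real j powr (-2 * \<alpha>))"
    and test_decay: "(\<lambda>j. \<phi> j \<bullet> \<Lambda>' (\<phi> j)) \<in> \<Theta>(\<lambda>j. real j powr (-2 * \<alpha>'))"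
    and moments: "moment_assumption \<phi> \<nu> \<Lambda>"
  shows "(\<forall>\<tau> :: nat \<Rightarrow> real.
            (\<forall>n\<ge>1. \<tau> n > 0) \<and> \<tau> \<longlonglongrightarrow> 0 \<and> filterlim (\<lambda>n. real n * \<tau> n) at_top sequentially \<longrightarrow>
            ennreal_bigomega (\<lambda>N. mean_test_error \<phi> \<nu> l \<gamma> \<sigma> b \<nu>' N)
              (\<lambda>N. ennreal (\<tau> N * rate \<alpha> \<alpha>' p N) + tail_sum \<alpha>' l (J_cut \<alpha> p N))) \<and>
         ennreal_bigomega (\<lambda>N. full_test_error \<phi> \<nu> l \<gamma> \<sigma> b \<nu>' N)
           (\<lambda>N. ennreal (rate \<alpha> \<alpha>' p N) + tail_sum \<alpha>' l (J_cut \<alpha> p N))"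
proof -
  define \<theta> where "\<theta> j = \<phi> j \<bullet> \<Lambda> (\<phi> j)" for j
  define \<theta>' where "\<theta>' j = \<phi> j \<bullet> \<Lambda>' (\<phi> j)" for j
  define a where "a N j = real N * (1 / \<gamma>\<^sup>2) * (\<sigma> j)\<^sup>2" for N j
  have pos: "0 < \<alpha> + p" using min_p by linarith
  have prob: "prob_space \<nu>" and sets: "sets \<nu> = sets borel"
    and cov: "covariance_wrt inner \<nu> \<Lambda>" and posdef: "\<And>u. u \<noteq> 0 \<Longrightarrow> 0 < u \<bullet> \<Lambda> u"
    using training by (auto simp: training_distribution_def)
  have cov': "covariance_wrt b \<nu>' \<Lambda>'"
    using test by (simp add: test_distribution_def)
  have KL: "karhunen_loeve_condition \<nu> \<Lambda>"
    using moments by (simp add: moment_assumption_def)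
  obtain K where K: "1 \<le> K" "\<And>u. integrable \<nu> (\<lambda>x. (u \<bullet> x) ^ 4)"
    "\<And>u. (\<integral>x. (u \<bullet> x) ^ 4 \<partial>\<nu>) \<le> K * (u \<bullet> \<Lambda> u)\<^sup>2"
    using fourth_moment_le_of_karhunen_loeve[OF prob sets cov KL] by blast
  have \<theta>_eq: "integrable \<nu> (\<lambda>x. (\<phi> j \<bullet> x)\<^sup>2)" "(\<integral>x. (\<phi> j \<bullet> x)\<^sup>2 \<partial>\<nu>) = \<theta> j" for j
    using cov by (auto simp: covariance_wrt_def power2_eq_square \<theta>_def)
  have \<theta>_pos: "0 < \<theta> j" if "1 \<le> j" for j
    using basis that unfolding \<theta>_def orthonormal_basis_def
    by (intro posdef) (metis inner_zero_left zero_neq_one)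
  have \<theta>_nonneg: "0 \<le> \<theta> j" for j
    unfolding \<theta>_eq(2)[symmetric] by (rule Bochner_Integration.integral_nonneg) simp
  have \<theta>'_nonneg: "0 \<le> \<theta>' j" for j
  proof -
    have "\<theta>' j = (\<integral>x. (b (\<phi> j) x)\<^sup>2 \<partial>\<nu>')"
      using cov' by (auto simp: covariance_wrt_def power2_eq_square \<theta>'_def)
    then show ?thesis by (simp add: Bochner_Integration.integral_nonneg)
  qed
  obtain s1 S1 where s1: "0 < s1" "0 < S1" "\<forall>\<^sub>F j in sequentially.
      s1 * real j powr (-2 * p) \<le> (\<sigma> j)\<^sup>2 \<and> (\<sigma> j)\<^sup>2 \<le> S1 * real j powr (-2 * p)"
    using bigtheta_powr_bounds[OF prior_decay] by auto
  obtain t1 T1 where t1: "0 < t1" "0 < T1" "\<forall>\<^sub>F j in sequentially.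
      t1 * real j powr (-2 * \<alpha>) \<le> \<theta> j \<and> \<theta> j \<le> T1 * real j powr (-2 * \<alpha>)"
    using bigtheta_powr_bounds[OF training_decay[folded \<theta>_def] \<theta>_nonneg] by auto
  obtain v1 V1 where v1: "0 < v1" "0 < V1" "\<forall>\<^sub>F j in sequentially.
      v1 * real j powr (-2 * \<alpha>') \<le> \<theta>' j \<and> \<theta>' j \<le> V1 * real j powr (-2 * \<alpha>')"
    using bigtheta_powr_bounds[OF test_decay[folded \<theta>'_def] \<theta>'_nonneg] by auto
  have "\<forall>\<^sub>F j in sequentially. 1 \<le> j \<and>
      (s1 * real j powr (-2 * p) \<le> (\<sigma> j)\<^sup>2 \<and> (\<sigma> j)\<^sup>2 \<le> S1 * real j powr (-2 * p)) \<and>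
      (t1 * real j powr (-2 * \<alpha>) \<le> \<theta> j \<and> \<theta> j \<le> T1 * real j powr (-2 * \<alpha>)) \<and>
      v1 * real j powr (-2 * \<alpha>') \<le> \<theta>' j"
    using s1(3) t1(3) v1(3) eventually_ge_at_top[of 1] by eventually_elim auto
  then obtain j0 where "\<And>j. j0 \<le> j \<Longrightarrow> 1 \<le> j \<and>
      (s1 * real j powr (-2 * p) \<le> (\<sigma> j)\<^sup>2 \<and> (\<sigma> j)\<^sup>2 \<le> S1 * real j powr (-2 * p)) \<and>
      (t1 * real j powr (-2 * \<alpha>) \<le> \<theta> j \<and> \<theta> j \<le> T1 * real j powr (-2 * \<alpha>)) \<and>
      v1 * real j powr (-2 * \<alpha>') \<le> \<theta>' j"
    unfolding eventually_sequentially by blast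
  then have j0: "1 \<le> j0"
    and \<sigma>_bounds: "\<And>j. j0 \<le> j \<Longrightarrow> s1 * real j powr (-2 * p) \<le> (\<sigma> j)\<^sup>2 \<and> (\<sigma> j)\<^sup>2 \<le> S1 * real j powr (-2 * p)"
    and \<theta>_bounds: "\<And>j. j0 \<le> j \<Longrightarrow> t1 * real j powr (-2 * \<alpha>) \<le> \<theta> j \<and> \<theta> j \<le> T1 * real j powr (-2 * \<alpha>)"
    and \<theta>'_bound: "\<And>j. j0 \<le> j \<Longrightarrow> v1 * real j powr (-2 * \<alpha>') \<le> \<theta>' j"
    by blast+
  have a0: "0 \<le> a N j" for N j by (simp add: a_def)
  \<comment> \<open>Up to constants \<open>snr N j\<close> is \<open>a N j * \<theta> j\<close>, the weight of the data relative to the prior in coordinate \<open>j\<close>.\<close>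
  define snr where "snr N j = real N * real j powr (-2 * (\<alpha> + p))" for N j :: nat
  define r where "r = s1 * t1 / \<gamma>\<^sup>2"
  define R where "R = S1 * T1 / \<gamma>\<^sup>2"
  have rR: "0 < r" "0 < R" using s1 t1 gamma by (auto simp: r_def R_def)
  have A_bounds: "r * snr N j \<le> a N j * \<theta> j" "a N j * \<theta> j \<le> R * snr N j" if j: "j0 \<le> j" for N j
  proof -
    let ?n = "real N * (1 / \<gamma>\<^sup>2)"
    have split: "real j powr (-2 * (\<alpha> + p)) = real j powr (-2 * p) * real j powr (-2 * \<alpha>)"
      by (simp add: powr_add[symmetric] algebra_simps)
    have "r * snr N j = ?n * ((s1 * real j powr (-2 * p)) * (t1 * real j powr (-2 * \<alpha>)))"
      unfolding r_def snr_def split by simp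
    also have "\<dots> \<le> ?n * ((\<sigma> j)\<^sup>2 * \<theta> j)"
      using \<sigma>_bounds[OF j] \<theta>_bounds[OF j] s1 t1 by (intro mult_left_mono mult_mono) auto
    finally show "r * snr N j \<le> a N j * \<theta> j" by (simp add: a_def)
    have "a N j * \<theta> j = ?n * ((\<sigma> j)\<^sup>2 * \<theta> j)" by (simp add: a_def)
    also have "\<dots> \<le> ?n * ((S1 * real j powr (-2 * p)) * (T1 * real j powr (-2 * \<alpha>)))"
      using \<sigma>_bounds[OF j] \<theta>_bounds[OF j] s1 t1 \<theta>_nonneg by (intro mult_left_mono mult_mono) auto
    also have "\<dots> = R * snr N j"
      unfolding R_def snr_def split by simp
    finally show "a N j * \<theta> j \<le> R * snr N j" .
  qed
  define \<kappa> where "\<kappa> = (1 + 2 * K)\<^sup>2"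
  have \<kappa>: "0 < \<kappa>" unfolding \<kappa>_def using K(1) by simp
  define bound where "bound N j = (l j)\<^sup>2 / (1 + a N j * \<theta> j)\<^sup>2 +
      (a N j * \<gamma>)\<^sup>2 / real N * (\<theta> j / (2 * \<kappa> * (1 + a N j * \<theta> j)\<^sup>2))" for N j
  define w where "w N j = \<theta>' j * bound N j" for N j
  \<comment> \<open>The two entries are the constants of the tail estimate and of the head estimate.\<close>
  define c where "c = min (v1 / (1 + R)\<^sup>2) (v1 * \<gamma>\<^sup>2 * (r / (1 + r))\<^sup>2 / (2 * \<kappa> * T1))"
  have c: "0 < c"
    using v1 rR gamma \<kappa> t1 by (simp add: c_def)
  have head: "c * (real j powr (2 * (\<alpha> - \<alpha>')) / real N) \<le> w N j"
    if N: "1 \<le> N" and j: "j0 \<le> j" and cut: "j \<le> J_cut \<alpha> p N" for N j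
  proof -
    have j1: "1 \<le> j" using j j0 by simp
    have "1 \<le> snr N j"
      using le_J_cut_iff[OF pos j1 N] cut by (simp add: snr_def)
    then have "r * 1 \<le> r * snr N j"
      using rR by (intro mult_left_mono) auto
    then have "r \<le> a N j * \<theta> j"
      using A_bounds(1)[OF j, of N] by linarith
    moreover have "\<theta> j \<le> T1 / real j powr (2 * \<alpha>)"
      using \<theta>_bounds[OF j] by (simp add: powr_minus_divide)
    ultimately have "v1 * \<gamma>\<^sup>2 * (r / (1 + r))\<^sup>2 / (2 * \<kappa> * T1) *
        (real j powr (-2 * \<alpha>') * real j powr (2 * \<alpha>) / real N) \<le> w N j"
      unfolding w_def bound_def using a0 \<theta>_pos[OF j1] rR j1 t1 N \<kappa> v1 \<theta>'_bound[OF j]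
      by (intro coordinate_bound_head) auto
    moreover have "real j powr (-2 * \<alpha>') * real j powr (2 * \<alpha>) = real j powr (2 * (\<alpha> - \<alpha>'))"
      by (simp add: powr_add[symmetric] algebra_simps)
    moreover have "c * (real j powr (2 * (\<alpha> - \<alpha>')) / real N) \<le>
        v1 * \<gamma>\<^sup>2 * (r / (1 + r))\<^sup>2 / (2 * \<kappa> * T1) * (real j powr (2 * (\<alpha> - \<alpha>')) / real N)"
      unfolding c_def by (intro mult_right_mono) auto
    ultimately show ?thesis by simp
  qed
  have tail: "c * (real j powr (-2 * \<alpha>') * \<bar>l j\<bar>\<^sup>2) \<le> w N j"
    if N: "1 \<le> N" and j: "j0 \<le> j" and cut: "J_cut \<alpha> p N < j" for N j
  proof -
    have j1: "1 \<le> j" using j j0 by simp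
    have "snr N j \<le> 1"
      using le_J_cut_iff[OF pos j1 N] cut by (simp add: snr_def)
    then have "R * snr N j \<le> R * 1"
      using rR by (intro mult_left_mono) auto
    then have "a N j * \<theta> j \<le> R"
      using A_bounds(2)[OF j, of N] by linarith
    then have "v1 / (1 + R)\<^sup>2 * (real j powr (-2 * \<alpha>') * (l j)\<^sup>2) \<le> w N j"
      unfolding w_def bound_def using a0 \<theta>_nonneg v1 \<theta>'_bound[OF j] \<kappa>
      by (intro coordinate_bound_tail) auto
    moreover have "c * (real j powr (-2 * \<alpha>') * (l j)\<^sup>2) \<le>
        v1 / (1 + R)\<^sup>2 * (real j powr (-2 * \<alpha>') * (l j)\<^sup>2)"
      unfolding c_def by (intro mult_right_mono) auto
    ultimately show ?thesis by simp
  qed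
  have coord: "(\<Sum>j\<in>F. ennreal (w N j)) \<le> (\<Sum>j\<in>F. ennreal (\<phi> j \<bullet> \<Lambda>' (\<phi> j)) *
      (\<integral>\<^sup>+D. ennreal ((l j - post_mean \<phi> \<sigma> \<gamma> N D j)\<^sup>2) \<partial>data_law \<phi> \<nu> l \<gamma> N))"
    if N: "1 \<le> N" and F: "F \<subseteq> {1..}" for N F
  proof (rule sum_mono)
    fix j assume "j \<in> F"
    then have j: "1 \<le> j" using F by auto
    have "ennreal (w N j) = ennreal (\<theta>' j) * ennreal (bound N j)"
      unfolding w_def by (rule ennreal_mult'[OF \<theta>'_nonneg])
    also have "\<dots> \<le> ennreal (\<theta>' j) *
        (\<integral>\<^sup>+D. ennreal ((l j - post_mean \<phi> \<sigma> \<gamma> N D j)\<^sup>2) \<partial>data_law \<phi> \<nu> l \<gamma> N)"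
      unfolding bound_def \<kappa>_def
      by (intro mult_left_mono coordinate_error_ge[where \<phi> = \<phi> and j = j, OF prob sets
            \<theta>_pos[OF j] \<theta>_eq K(1) K(2) K(3)[of "\<phi> j", folded \<theta>_def] gamma j N a_def]) simp
    finally show "ennreal (w N j) \<le> ennreal (\<phi> j \<bullet> \<Lambda>' (\<phi> j)) *
        (\<integral>\<^sup>+D. ennreal ((l j - post_mean \<phi> \<sigma> \<gamma> N D j)\<^sup>2) \<partial>data_law \<phi> \<nu> l \<gamma> N)"
      by (simp add: \<theta>'_def)
  qed
  have mean: "ennreal_bigomega (\<lambda>N. mean_test_error \<phi> \<nu> l \<gamma> \<sigma> b \<nu>' N)
      (\<lambda>N. ennreal (\<tau> N * rate \<alpha> \<alpha>' p N) + tail_sum \<alpha>' l (J_cut \<alpha> p N))"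
    if "\<tau> \<longlonglongrightarrow> 0" for \<tau> :: "nat \<Rightarrow> real"
  proof (rule ennreal_bigomega_rate_tail[OF pos c j0 _ head tail])
    show "\<forall>\<^sub>F N in sequentially. \<tau> N \<le> 1"
      using order_tendstoD(2)[OF that, of 1] by (auto elim: eventually_mono)
    show "(\<Sum>j\<in>F. ennreal (w N j)) \<le> mean_test_error \<phi> \<nu> l \<gamma> \<sigma> b \<nu>' N"
      if "1 \<le> N" "finite F" "F \<subseteq> {1..}" for N F
      using coord[OF that(1,3)] mean_test_error_ge_sum[OF basis sets cov' that(2,3)] by (rule order_trans)
  qed
  have full: "ennreal_bigomega (\<lambda>N. full_test_error \<phi> \<nu> l \<gamma> \<sigma> b \<nu>' N)
      (\<lambda>N. ennreal (1 * rate \<alpha> \<alpha>' p N) + tail_sum \<alpha>' l (J_cut \<alpha> p N))"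
  proof (rule ennreal_bigomega_rate_tail[OF pos c j0 _ head tail])
    show "(\<Sum>j\<in>F. ennreal (w N j)) \<le> full_test_error \<phi> \<nu> l \<gamma> \<sigma> b \<nu>' N"
      if "1 \<le> N" "finite F" "F \<subseteq> {1..}" for N F
      using coord[OF that(1,3)] full_test_error_ge_sum[OF basis sets prior cov' that(2,3)] by (rule order_trans)
  qed auto
  from mean full show ?thesis by simp
qed

end
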